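(* Let $(M,g,f,\lambda)$ be a gradient Yamabe soliton of dimension $n\ge 2$ with scalar curvature $R$. Then $$\Delta R=-\frac{1}{n-1}\Big\{\frac12\,\nabla_l R\,\nabla_l f+R(R-\lambda)\Big\},$$ where $\nabla_l R\,\nabla_l f=g(\nabla R,\nabla f)$ (summation over the repeated index $l$).
   Context: A gradient Yamabe soliton $(M,g,f,\lambda)$ of dimension $n$ ($n\ge 2$) is a connected Riemannian manifold $(M,g)$ of dimension $n$ together with a constant $\lambda\in\mathbb{R}$ and a smooth function $f:M\to\mathbb{R}$ (the potential function) such that $\nabla^2 f=(R-\lambda)g$, where $\nabla^2 f$ is the Hessian of $f$ and $R$ is the scalar curvature of $(M,g)$. The Laplacian $\Delta$ is the trace of the Hessian with respect to $g$. *)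

theory Defs
  imports "HOL-Analysis.Analysis"
begin

section \<open>Smooth functions on open subsets of Euclidean space\<close>

definition partial_deriv :: "'n::finite \<Rightarrow> (real^'n \<Rightarrow> real) \<Rightarrow> real^'n \<Rightarrow> real" where
  "partial_deriv i F x = frechet_derivative F (at x) (axis i 1)"

text \<open>Only used for open \<open>S\<close>.\<close>

primrec Ck_on :: "nat \<Rightarrow> (real^'n::finite \<Rightarrow> real) \<Rightarrow> (real^'n) set \<Rightarrow> bool" where
  "Ck_on 0 F S \<longleftrightarrow> continuous_on S F"
| "Ck_on (Suc k) F S \<longleftrightarrow> F differentiable_on S \<and> (\<forall>i. Ck_on k (partial_deriv i F) S)"

definition smooth_on :: "(real^'n::finite) set \<Rightarrow> (real^'n \<Rightarrow> real) \<Rightarrow> bool" where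
  "smooth_on S F \<longleftrightarrow> (\<forall>k. Ck_on k F S)"


section \<open>Smooth manifolds\<close>

text \<open>
  A chart is a pair \<open>(U, \<phi>)\<close>; the values of \<open>\<phi>\<close> outside \<open>U\<close> are irrelevant.  Likewise a
  function on the manifold is a HOL function on the whole type, of which only the values on
  \<open>topspace X\<close> matter.  The dimension of the manifold is \<open>CARD('n)\<close>.
\<close>

type_synonym ('a, 'n) chart = "'a set \<times> ('a \<Rightarrow> real^'n)"

definition chart_inv :: "('a, 'n::finite) chart \<Rightarrow> real^'n \<Rightarrow> 'a" where
  "chart_inv c = inv_into (fst c) (snd c)"

definition is_chart :: "'a topology \<Rightarrow> ('a, 'n::finite) chart \<Rightarrow> bool" where
  "is_chart X c \<longleftrightarrow>
     openin X (fst c) \<and> open (snd c ` fst c) \<and>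
     homeomorphic_map (subtopology X (fst c)) (top_of_set (snd c ` fst c)) (snd c)"

definition smooth_atlas :: "'a topology \<Rightarrow> ('a, 'n::finite) chart set \<Rightarrow> bool" where
  "smooth_atlas X A \<longleftrightarrow>
     (\<forall>c\<in>A. is_chart X c) \<and> (\<Union>c\<in>A. fst c) = topspace X \<and>
     (\<forall>c\<in>A. \<forall>d\<in>A. \<forall>i. smooth_on (snd c ` (fst c \<inter> fst d)) (\<lambda>x. snd d (chart_inv c x) $ i))"

text \<open>The atlas need not be maximal; it determines the smooth structure.\<close>

definition smooth_manifold :: "'a topology \<Rightarrow> ('a, 'n::finite) chart set \<Rightarrow> bool" where
  "smooth_manifold X A \<longleftrightarrow> Hausdorff_space X \<and> second_countable X \<and> smooth_atlas X A"

definition smooth_fun_on :: "('a, 'n::finite) chart set \<Rightarrow> 'a set \<Rightarrow> ('a \<Rightarrow> real) \<Rightarrow> bool" where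
  "smooth_fun_on A U F \<longleftrightarrow> (\<forall>c\<in>A. smooth_on (snd c ` (fst c \<inter> U)) (F \<circ> chart_inv c))"

definition smooth_near ::
    "'a topology \<Rightarrow> ('a, 'n::finite) chart set \<Rightarrow> 'a \<Rightarrow> ('a \<Rightarrow> real) \<Rightarrow> bool" where
  "smooth_near X A p F \<longleftrightarrow> (\<exists>U. openin X U \<and> p \<in> U \<and> smooth_fun_on A U F)"


section \<open>Tangent spaces and Riemannian metrics\<close>

text \<open>
  Tangent vectors at \<open>p\<close> are the derivations at \<open>p\<close> of the functions that are smooth near \<open>p\<close>,
  extended by \<open>0\<close> to all other functions so that equal derivations are equal HOL functions.
  The Leibniz rule forces a derivation to depend only on the germ at \<open>p\<close>.
\<close>

definition tangent_space ::
    "'a topology \<Rightarrow> ('a, 'n::finite) chart set \<Rightarrow> 'a \<Rightarrow> (('a \<Rightarrow> real) \<Rightarrow> real) set" where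
  "tangent_space X A p =
     {v. (\<forall>F. \<not> smooth_near X A p F \<longrightarrow> v F = 0) \<and>
         (\<forall>F G a. smooth_near X A p F \<longrightarrow> smooth_near X A p G \<longrightarrow>
            v (\<lambda>q. F q + G q) = v F + v G \<and>
            v (\<lambda>q. a * F q) = a * v F \<and>
            v (\<lambda>q. F q * G q) = v F * G p + F p * v G)}"

definition coord_vector ::
    "'a topology \<Rightarrow> ('a, 'n::finite) chart set \<Rightarrow> ('a, 'n) chart \<Rightarrow> 'a \<Rightarrow> 'n \<Rightarrow>
     ('a \<Rightarrow> real) \<Rightarrow> real" where
  "coord_vector X A c p i =
     (\<lambda>F. if smooth_near X A p F then partial_deriv i (F \<circ> chart_inv c) (snd c p) else 0)"

type_synonym 'a metric_tensor =
  "'a \<Rightarrow> (('a \<Rightarrow> real) \<Rightarrow> real) \<Rightarrow> (('a \<Rightarrow> real) \<Rightarrow> real) \<Rightarrow> real"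

text \<open>The matrix \<open>g\<^sub>i\<^sub>j\<close> of \<open>g\<close> in the chart \<open>c\<close>, as a function of the coordinates.\<close>

definition metric_matrix ::
    "'a topology \<Rightarrow> ('a, 'n::finite) chart set \<Rightarrow> 'a metric_tensor \<Rightarrow> ('a, 'n) chart \<Rightarrow>
     real^'n \<Rightarrow> real^'n^'n" where
  "metric_matrix X A g c x =
     (\<chi> i j. g (chart_inv c x) (coord_vector X A c (chart_inv c x) i)
                               (coord_vector X A c (chart_inv c x) j))"

definition riemannian_metric ::
    "'a topology \<Rightarrow> ('a, 'n::finite) chart set \<Rightarrow> 'a metric_tensor \<Rightarrow> bool" where
  "riemannian_metric X A g \<longleftrightarrow>
     (\<forall>p\<in>topspace X. \<forall>u\<in>tangent_space X A p. \<forall>v\<in>tangent_space X A p.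
        g p u v = g p v u \<and>
        (\<forall>w\<in>tangent_space X A p. \<forall>a b.
           g p (\<lambda>F. a * u F + b * v F) w = a * g p u w + b * g p v w)) \<and>
     (\<forall>p\<in>topspace X. \<forall>u\<in>tangent_space X A p. u \<noteq> (\<lambda>F. 0) \<longrightarrow> g p u u > 0) \<and>
     (\<forall>c\<in>A. \<forall>i j. smooth_on (snd c ` fst c) (\<lambda>x. metric_matrix X A g c x $ i $ j))"

definition riemannian_manifold ::
    "'a topology \<Rightarrow> ('a, 'n::finite) chart set \<Rightarrow> 'a metric_tensor \<Rightarrow> bool" where
  "riemannian_manifold X A g \<longleftrightarrow> smooth_manifold X A \<and> riemannian_metric X A g"


section \<open>Curvature and Hessian in local coordinates\<close>

text \<open>In this section \<open>G\<close> is the matrix of a metric on a coordinate domain.\<close>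

text \<open>\<open>\<Gamma>\<^sup>k\<^sub>i\<^sub>j = 1/2 g\<^sup>k\<^sup>l (\<partial>\<^sub>i g\<^sub>j\<^sub>l + \<partial>\<^sub>j g\<^sub>i\<^sub>l - \<partial>\<^sub>l g\<^sub>i\<^sub>j)\<close>\<close>

definition christoffel ::
    "(real^'n::finite \<Rightarrow> real^'n^'n) \<Rightarrow> 'n \<Rightarrow> 'n \<Rightarrow> 'n \<Rightarrow> real^'n \<Rightarrow> real" where
  "christoffel G k i j x =
     1/2 * (\<Sum>l\<in>UNIV. matrix_inv (G x) $ k $ l *
        (partial_deriv i (\<lambda>y. G y $ j $ l) x + partial_deriv j (\<lambda>y. G y $ i $ l) x
         - partial_deriv l (\<lambda>y. G y $ i $ j) x))"

text \<open>
  The coefficients in \<open>R(\<partial>\<^sub>i, \<partial>\<^sub>j) \<partial>\<^sub>k = R\<^sup>l\<^sub>i\<^sub>j\<^sub>k \<partial>\<^sub>l\<close>, where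
  \<open>R(X, Y) Z = \<nabla>\<^sub>X \<nabla>\<^sub>Y Z - \<nabla>\<^sub>Y \<nabla>\<^sub>X Z - \<nabla>\<^bsub>[X, Y]\<^esub> Z\<close>.
\<close>

definition riemann_tensor ::
    "(real^'n::finite \<Rightarrow> real^'n^'n) \<Rightarrow> 'n \<Rightarrow> 'n \<Rightarrow> 'n \<Rightarrow> 'n \<Rightarrow> real^'n \<Rightarrow> real" where
  "riemann_tensor G l i j k x =
     partial_deriv i (christoffel G l j k) x - partial_deriv j (christoffel G l i k) x
     + (\<Sum>m\<in>UNIV. christoffel G l i m x * christoffel G m j k x
                   - christoffel G l j m x * christoffel G m i k x)"

text \<open>
  \<open>Ric(Y, Z)\<close> is the trace of \<open>X \<mapsto> R(X, Y) Z\<close>, so that round spheres have positive Ricci and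
  scalar curvature.
\<close>

definition ricci_tensor ::
    "(real^'n::finite \<Rightarrow> real^'n^'n) \<Rightarrow> 'n \<Rightarrow> 'n \<Rightarrow> real^'n \<Rightarrow> real" where
  "ricci_tensor G j k x = (\<Sum>i\<in>UNIV. riemann_tensor G i i j k x)"

definition coord_scalar_curvature ::
    "(real^'n::finite \<Rightarrow> real^'n^'n) \<Rightarrow> real^'n \<Rightarrow> real" where
  "coord_scalar_curvature G x =
     (\<Sum>j\<in>UNIV. \<Sum>k\<in>UNIV. matrix_inv (G x) $ j $ k * ricci_tensor G j k x)"

text \<open>\<open>\<nabla>\<^sub>i \<nabla>\<^sub>j F = \<partial>\<^sub>i \<partial>\<^sub>j F - \<Gamma>\<^sup>k\<^sub>i\<^sub>j \<partial>\<^sub>k F\<close>\<close>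

definition coord_hessian ::
    "(real^'n::finite \<Rightarrow> real^'n^'n) \<Rightarrow> (real^'n \<Rightarrow> real) \<Rightarrow> 'n \<Rightarrow> 'n \<Rightarrow> real^'n \<Rightarrow> real" where
  "coord_hessian G F i j x =
     partial_deriv i (partial_deriv j F) x
     - (\<Sum>k\<in>UNIV. christoffel G k i j x * partial_deriv k F x)"


section \<open>Curvature, gradient, Hessian and Laplacian on a Riemannian manifold\<close>

text \<open>
  Scalar curvature, gradient and Laplacian at \<open>p\<close> are computed in some chart around \<open>p\<close>, which may
  vary with \<open>p\<close>; by coordinate invariance the result does not depend on this choice.
\<close>

definition chart_at :: "('a, 'n::finite) chart set \<Rightarrow> 'a \<Rightarrow> ('a, 'n) chart" where
  "chart_at A p = (SOME c. c \<in> A \<and> p \<in> fst c)"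

definition scalar_curvature ::
    "'a topology \<Rightarrow> ('a, 'n::finite) chart set \<Rightarrow> 'a metric_tensor \<Rightarrow> 'a \<Rightarrow> real" where
  "scalar_curvature X A g p =
     (let c = chart_at A p in coord_scalar_curvature (metric_matrix X A g c) (snd c p))"

definition hessian ::
    "'a topology \<Rightarrow> ('a, 'n::finite) chart set \<Rightarrow> 'a metric_tensor \<Rightarrow> ('a, 'n) chart \<Rightarrow>
     ('a \<Rightarrow> real) \<Rightarrow> 'n \<Rightarrow> 'n \<Rightarrow> 'a \<Rightarrow> real" where
  "hessian X A g c F i j p =
     coord_hessian (metric_matrix X A g c) (F \<circ> chart_inv c) i j (snd c p)"

definition laplacian ::
    "'a topology \<Rightarrow> ('a, 'n::finite) chart set \<Rightarrow> 'a metric_tensor \<Rightarrow> ('a \<Rightarrow> real) \<Rightarrow>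
     'a \<Rightarrow> real" where
  "laplacian X A g F p =
     (let c = chart_at A p in
      \<Sum>i\<in>UNIV. \<Sum>j\<in>UNIV. matrix_inv (metric_matrix X A g c (snd c p)) $ i $ j *
        hessian X A g c F i j p)"

text \<open>\<open>\<nabla>F = g\<^sup>i\<^sup>j (\<partial>\<^sub>i F) \<partial>\<^sub>j\<close>, as a tangent vector at \<open>p\<close>\<close>

definition gradient ::
    "'a topology \<Rightarrow> ('a, 'n::finite) chart set \<Rightarrow> 'a metric_tensor \<Rightarrow> ('a \<Rightarrow> real) \<Rightarrow>
     'a \<Rightarrow> ('a \<Rightarrow> real) \<Rightarrow> real" where
  "gradient X A g F p =
     (let c = chart_at A p in
      (\<lambda>H. \<Sum>i\<in>UNIV. \<Sum>j\<in>UNIV. matrix_inv (metric_matrix X A g c (snd c p)) $ i $ j *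
        partial_deriv i (F \<circ> chart_inv c) (snd c p) * coord_vector X A c p j H))"

definition gradient_yamabe_soliton ::
    "'a topology \<Rightarrow> ('a, 'n::finite) chart set \<Rightarrow> 'a metric_tensor \<Rightarrow> ('a \<Rightarrow> real) \<Rightarrow>
     real \<Rightarrow> bool" where
  "gradient_yamabe_soliton X A g f lam \<longleftrightarrow>
     connected_space X \<and> riemannian_manifold X A g \<and> smooth_fun_on A (topspace X) f \<and>
     (\<forall>c\<in>A. \<forall>p\<in>fst c. \<forall>i j.
        hessian X A g c f i j p =
        (scalar_curvature X A g p - lam) * g p (coord_vector X A c p i) (coord_vector X A c p j))"

end

theory Submission
  imports Defs
begin

text \<open>
  Write \<open>s = R - \<lambda>\<close>, so that the soliton equation reads \<open>Hess f = s g\<close>.  Classically, commuting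
  derivatives of \<open>df\<close> gives \<open>(n - 1) \<nabla>\<^sub>i s = - Ric\<^sub>i\<^sub>l \<nabla>\<^sup>l f\<close>.  Taking the divergence of this, the contracted
  second Bianchi identity \<open>\<nabla>\<^sup>i Ric\<^sub>i\<^sub>l = 1/2 \<nabla>\<^sub>l R\<close> produces the gradient term and
  \<open>Ric\<^sub>i\<^sub>l \<nabla>\<^sup>i \<nabla>\<^sup>l f = s R\<close> the other one.

  Both steps are done here at once, at the origin of a normal coordinate system, where \<open>g\<^sub>i\<^sub>j = \<delta>\<^sub>i\<^sub>j\<close> and
  \<open>\<Gamma> = 0\<close>.  There the equation \<open>\<partial>\<^sub>j \<partial>\<^sub>k f - \<Gamma>\<^sup>l\<^sub>j\<^sub>k \<partial>\<^sub>l f = s g\<^sub>j\<^sub>k\<close>, differentiated by \<open>\<partial>\<^sub>m \<partial>\<^sub>i\<close>, antisymmetrised in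
  \<open>i, j\<close> and contracted with \<open>m = i\<close>, \<open>j = k\<close>, loses its fourth derivatives of \<open>f\<close>; what remains consists of
  \<open>\<Delta> s\<close>, of second derivatives of \<open>g\<close>, which assemble to \<open>s R\<close>, and of third derivatives of \<open>g\<close>.  At such a
  point the contracted Bianchi identity is nothing but the symmetry of third partial derivatives
  (\<open>contracted_third_derivatives\<close>).  This is \<open>conformal_gradient_at_origin\<close>.

  Everything else is coordinate invariance.  If \<open>G\<close> is the pullback of \<open>H\<close> by a map with Jacobian
  matrix \<open>J\<close>, the connection matrices obey a gauge transformation law (\<open>connection_transformation\<close>);
  curvature and Hessian therefore transform as tensors, and full contractions are invariant.  This is used
  twice.  A quadratic change of coordinates, which need not belong to the atlas, produces normal
  coordinates (\<open>normal_coordinates\<close>).  And scalar curvature, which at each point is computed in a chart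
  depending on that point, can be differentiated only after all its values near a point have been
  expressed in one chart (\<open>scalar_curvature_in_chart\<close>).
\<close>

section \<open>Partial derivatives\<close>

lemma partial_deriv_eqI:
  "(F has_derivative D) (at x) \<Longrightarrow> partial_deriv i F x = D (axis i 1)"
  unfolding partial_deriv_def using frechet_derivative_at by metis

lemma has_derivative_partial:
  fixes F :: "real^'n::finite \<Rightarrow> real"
  assumes "F differentiable (at x)"
  shows "(F has_derivative (\<lambda>h. \<Sum>i\<in>UNIV. partial_deriv i F x * h $ i)) (at x)"
proof -
  have D: "(F has_derivative frechet_derivative F (at x)) (at x)"
    using assms frechet_derivative_works by blast
  interpret linear "frechet_derivative F (at x)"
    using D has_derivative_linear by blast
  have "frechet_derivative F (at x) h = (\<Sum>i\<in>UNIV. partial_deriv i F x * h $ i)" for h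
  proof -
    have "frechet_derivative F (at x) h = frechet_derivative F (at x) (\<Sum>i\<in>UNIV. h $ i *\<^sub>R axis i 1)"
      using basis_expansion[of h] by (simp add: scalar_mult_eq_scaleR)
    also have "\<dots> = (\<Sum>i\<in>UNIV. partial_deriv i F x * h $ i)"
      by (simp add: sum scale partial_deriv_def mult.commute)
    finally show ?thesis .
  qed
  then have "frechet_derivative F (at x) = (\<lambda>h. \<Sum>i\<in>UNIV. partial_deriv i F x * h $ i)"
    by blast
  with D show ?thesis by simp
qed

lemma partial_deriv_cong:
  assumes "open S" "x \<in> S" "\<And>y. y \<in> S \<Longrightarrow> F y = F' y"
  shows "partial_deriv i F x = partial_deriv i F' x"
proof -
  have "(F has_derivative D) (at x) \<longleftrightarrow> (F' has_derivative D) (at x)" for D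
    using has_derivative_transform_within_open[of F D x UNIV S F']
      has_derivative_transform_within_open[of F' D x UNIV S F] assms by auto
  then show ?thesis by (simp add: partial_deriv_def frechet_derivative_def)
qed

lemma partial_deriv_const [simp]: "partial_deriv i (\<lambda>y. c) x = 0"
  using partial_deriv_eqI[OF has_derivative_const[of c "at x"], of i] by simp

lemma partial_deriv_component: "partial_deriv i (\<lambda>y. y $ a) x = (if a = i then 1 else 0)"
proof -
  have "((\<lambda>y. y $ a) has_derivative (\<lambda>h. h $ a)) (at x)"
    by (rule bounded_linear_imp_has_derivative) (rule bounded_linear_vec_nth)
  from partial_deriv_eqI[OF this] show ?thesis by (simp add: axis_def)
qed

lemma partial_deriv_add:
  assumes "F differentiable (at x)" "H differentiable (at x)"
  shows "partial_deriv i (\<lambda>y. F y + H y) x = partial_deriv i F x + partial_deriv i H x"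
  using partial_deriv_eqI[OF has_derivative_add[OF assms[unfolded frechet_derivative_works]]]
  by (simp add: partial_deriv_def)

lemma partial_deriv_diff:
  assumes "F differentiable (at x)" "H differentiable (at x)"
  shows "partial_deriv i (\<lambda>y. F y - H y) x = partial_deriv i F x - partial_deriv i H x"
  using partial_deriv_eqI[OF has_derivative_diff[OF assms[unfolded frechet_derivative_works]]]
  by (simp add: partial_deriv_def)

lemma partial_deriv_mult:
  assumes "F differentiable (at x)" "H differentiable (at x)"
  shows "partial_deriv i (\<lambda>y. F y * H y) x = partial_deriv i F x * H x + F x * partial_deriv i H x"
  using partial_deriv_eqI[OF has_derivative_mult[OF assms[unfolded frechet_derivative_works]]]
  by (simp add: partial_deriv_def)

lemma partial_deriv_cmult:
  assumes "F differentiable (at x)"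
  shows "partial_deriv i (\<lambda>y. c * F y) x = c * partial_deriv i F x"
  using partial_deriv_mult[of "\<lambda>_. c" x F i] assms by simp

lemma partial_deriv_sum:
  assumes "\<And>a. a \<in> I \<Longrightarrow> F a differentiable (at x)"
  shows "partial_deriv i (\<lambda>y. \<Sum>a\<in>I. F a y) x = (\<Sum>a\<in>I. partial_deriv i (F a) x)"
proof -
  have "((\<lambda>y. \<Sum>a\<in>I. F a y) has_derivative (\<lambda>h. \<Sum>a\<in>I. frechet_derivative (F a) (at x) h)) (at x)"
    using assms by (intro has_derivative_sum) (simp add: frechet_derivative_works)
  from partial_deriv_eqI[OF this] show ?thesis by (simp add: partial_deriv_def)
qed

lemma partial_deriv_inverse:
  fixes F :: "real^'n::finite \<Rightarrow> real"
  assumes "F differentiable (at x)" "F x \<noteq> 0"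
  shows "partial_deriv i (\<lambda>y. inverse (F y)) x = - (inverse (F x) * partial_deriv i F x * inverse (F x))"
  using partial_deriv_eqI[OF Deriv.has_derivative_inverse
      [OF assms(2) assms(1)[unfolded frechet_derivative_works]]]
  by (simp add: partial_deriv_def)

lemma has_derivative_jacobian:
  fixes \<phi> :: "real^'n::finite \<Rightarrow> real^'m::finite"
  assumes "\<And>a. (\<lambda>y. \<phi> y $ a) differentiable (at x)"
  shows "(\<phi> has_derivative (\<lambda>h. \<chi> a. \<Sum>i\<in>UNIV. partial_deriv i (\<lambda>y. \<phi> y $ a) x * h $ i)) (at x)"
proof (subst has_derivative_componentwise_within, rule ballI)
  fix b :: "real^'m" assume "b \<in> Basis"
  then obtain a where b: "b = axis a 1" by (auto simp: Basis_vec_def)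
  show "((\<lambda>y. \<phi> y \<bullet> b) has_derivative
      (\<lambda>h. (\<chi> a. \<Sum>i\<in>UNIV. partial_deriv i (\<lambda>y. \<phi> y $ a) x * h $ i) \<bullet> b)) (at x)"
    using has_derivative_partial[OF assms, of a] by (simp add: b inner_axis)
qed

lemma differentiable_compose_components:
  fixes \<phi> :: "real^'n::finite \<Rightarrow> real^'m::finite"
  assumes "\<And>a. (\<lambda>y. \<phi> y $ a) differentiable (at x)" "F differentiable (at (\<phi> x))"
  shows "(\<lambda>y. F (\<phi> y)) differentiable (at x)"
  using differentiable_chain_at[of \<phi> x F] has_derivative_jacobian[OF assms(1)] assms(2)
  by (auto simp: differentiable_def o_def)

lemma partial_deriv_chain:
  fixes \<phi> :: "real^'n::finite \<Rightarrow> real^'m::finite"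
  assumes "\<And>a. (\<lambda>y. \<phi> y $ a) differentiable (at x)" "F differentiable (at (\<phi> x))"
  shows "partial_deriv i (\<lambda>y. F (\<phi> y)) x =
    (\<Sum>a\<in>UNIV. partial_deriv a F (\<phi> x) * partial_deriv i (\<lambda>y. \<phi> y $ a) x)"
proof -
  have "((\<lambda>y. F (\<phi> y)) has_derivative (\<lambda>h. \<Sum>a\<in>UNIV. partial_deriv a F (\<phi> x) *
      (\<chi> a. \<Sum>i\<in>UNIV. partial_deriv i (\<lambda>y. \<phi> y $ a) x * h $ i) $ a)) (at x)"
    using has_derivative_compose[OF has_derivative_jacobian[OF assms(1)] has_derivative_partial[OF assms(2)]]
    by simp
  from partial_deriv_eqI[OF this] show ?thesis
    by (simp add: axis_def if_distrib cong: if_cong)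
qed

section \<open>Functions of class \<open>C\<^sup>k\<close>\<close>

lemma Ck_on_Suc_differentiable:
  "Ck_on (Suc k) F S \<Longrightarrow> open S \<Longrightarrow> y \<in> S \<Longrightarrow> F differentiable (at y)"
  using differentiable_on_eq_differentiable_at by auto

lemma Ck_on_cong:
  assumes "open S" "\<And>y. y \<in> S \<Longrightarrow> F y = F' y" "Ck_on k F S"
  shows "Ck_on k F' S"
  using assms(2,3)
proof (induction k arbitrary: F F')
  case 0
  then show ?case using continuous_on_cong by force
next
  case (Suc k)
  have "F' differentiable_on S"
    unfolding differentiable_on_eq_differentiable_at[OF \<open>open S\<close>]
  proof
    fix x assume "x \<in> S"
    with Suc.prems obtain D where "(F has_derivative D) (at x)"
      using Ck_on_Suc_differentiable[OF _ \<open>open S\<close>] unfolding differentiable_def by blast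
    then have "(F' has_derivative D) (at x)"
      using has_derivative_transform_within_open[of F D x UNIV S F'] \<open>open S\<close> \<open>x \<in> S\<close> Suc.prems(1) by auto
    then show "F' differentiable (at x)"
      by (auto simp: differentiable_def)
  qed
  moreover have "Ck_on k (partial_deriv i F') S" for i
    using Suc.IH[of "partial_deriv i F" "partial_deriv i F'"] Suc.prems
      partial_deriv_cong[OF \<open>open S\<close>, of _ F F'] by auto
  ultimately show ?case by simp
qed

lemma Ck_on_subset: "Ck_on k F S \<Longrightarrow> T \<subseteq> S \<Longrightarrow> Ck_on k F T"
  by (induction k arbitrary: F)
    (auto intro: continuous_on_subset differentiable_on_subset)

lemma Ck_on_Suc_lower: "Ck_on (Suc k) F S \<Longrightarrow> Ck_on k F S"
  by (induction k arbitrary: F) (auto simp: differentiable_imp_continuous_on)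

lemma Ck_on_const: "Ck_on k (\<lambda>y. c) S"
proof (induction k arbitrary: c)
  case (Suc k)
  have "partial_deriv i (\<lambda>y. c) = (\<lambda>y. 0)" for i :: 'a
    by auto
  with Suc[of 0] show ?case by simp
qed simp

lemma Ck_on_add:
  assumes "open S" "Ck_on k F S" "Ck_on k H S"
  shows "Ck_on k (\<lambda>y. F y + H y) S"
  using assms(2,3)
proof (induction k arbitrary: F H)
  case 0
  then show ?case by (simp add: continuous_on_add)
next
  case (Suc k)
  have "Ck_on k (partial_deriv i (\<lambda>y. F y + H y)) S" for i
  proof (rule Ck_on_cong[OF \<open>open S\<close>])
    show "Ck_on k (\<lambda>y. partial_deriv i F y + partial_deriv i H y) S"
      using Suc by simp
    show "partial_deriv i F y + partial_deriv i H y = partial_deriv i (\<lambda>y. F y + H y) y" if "y \<in> S" for y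
      using Suc.prems[THEN Ck_on_Suc_differentiable] that \<open>open S\<close>
      by (simp add: partial_deriv_add)
  qed
  then show ?case using Suc.prems by simp
qed

lemma Ck_on_mult:
  assumes "open S" "Ck_on k F S" "Ck_on k H S"
  shows "Ck_on k (\<lambda>y. F y * H y) S"
  using assms(2,3)
proof (induction k arbitrary: F H)
  case 0
  then show ?case by (simp add: continuous_on_mult)
next
  case (Suc k)
  have "Ck_on k (partial_deriv i (\<lambda>y. F y * H y)) S" for i
  proof (rule Ck_on_cong[OF \<open>open S\<close>])
    show "Ck_on k (\<lambda>y. partial_deriv i F y * H y + F y * partial_deriv i H y) S"
      using Suc.prems Suc.prems[THEN Ck_on_Suc_lower]
      by (intro Ck_on_add Suc.IH \<open>open S\<close>) (simp_all del: split_paired_All)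
    show "partial_deriv i F y * H y + F y * partial_deriv i H y = partial_deriv i (\<lambda>y. F y * H y) y" if "y \<in> S" for y
      using Suc.prems[THEN Ck_on_Suc_differentiable] that \<open>open S\<close>
      by (simp add: partial_deriv_mult)
  qed
  then show ?case using Suc.prems by simp
qed

lemma Ck_on_inverse:
  assumes "open S" "Ck_on k F S" "\<And>y. y \<in> S \<Longrightarrow> F y \<noteq> 0"
  shows "Ck_on k (\<lambda>y. inverse (F y)) S"
  using assms(2)
proof (induction k)
  case 0
  then show ?case using assms(3) by (simp add: continuous_on_inverse)
next
  case (Suc k)
  have d: "F differentiable (at y)" if "y \<in> S" for y
    using Suc.prems that Ck_on_Suc_differentiable[OF _ \<open>open S\<close>] by blast
  have inv: "Ck_on k (\<lambda>y. inverse (F y)) S"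
    using Suc.IH Suc.prems Ck_on_Suc_lower by blast
  have "Ck_on k (partial_deriv i (\<lambda>y. inverse (F y))) S" for i
  proof (rule Ck_on_cong[OF \<open>open S\<close>])
    show "Ck_on k (\<lambda>y. (- 1) * (inverse (F y) * partial_deriv i F y * inverse (F y))) S"
      using Suc.prems inv by (intro Ck_on_mult Ck_on_const \<open>open S\<close>) auto
    show "(- 1) * (inverse (F y) * partial_deriv i F y * inverse (F y)) = partial_deriv i (\<lambda>y. inverse (F y)) y"
      if "y \<in> S" for y
      using that by (simp add: partial_deriv_inverse d assms(3))
  qed
  moreover have "(\<lambda>y. inverse (F y)) differentiable_on S"
    unfolding differentiable_on_eq_differentiable_at[OF \<open>open S\<close>] using d assms(3) by auto
  ultimately show ?case by simp
qed

lemma Ck_on_sum: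
  assumes "open S" "\<And>a. a \<in> I \<Longrightarrow> Ck_on k (F a) S"
  shows "Ck_on k (\<lambda>y. \<Sum>a\<in>I. F a y) S"
  using assms(2) by (induction I rule: infinite_finite_induct) (auto intro: Ck_on_add Ck_on_const assms(1))

lemma Ck_on_compose:
  fixes \<phi> :: "real^'n::finite \<Rightarrow> real^'m::finite"
  assumes "open S" "open T" "Ck_on k F T" "\<And>a. Ck_on k (\<lambda>y. \<phi> y $ a) S" "\<And>y. y \<in> S \<Longrightarrow> \<phi> y \<in> T"
  shows "Ck_on k (\<lambda>y. F (\<phi> y)) S"
  using assms(3,4)
proof (induction k arbitrary: F)
  case 0
  have "continuous_on S (\<lambda>y. \<chi> a. \<phi> y $ a)"
    by (intro continuous_on_vec_lambda) (use 0 in auto)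
  then have "continuous_on S \<phi>" by simp
  then show ?case
    using 0 assms(5) continuous_on_compose2[of T F S \<phi>] by (auto simp: image_subset_iff)
next
  case (Suc k)
  have d\<phi>: "(\<lambda>y. \<phi> y $ a) differentiable (at y)" if "y \<in> S" for y a
    using Suc.prems that Ck_on_Suc_differentiable[OF _ \<open>open S\<close>] by blast
  have dF: "F differentiable (at y)" if "y \<in> T" for y
    using Suc.prems that Ck_on_Suc_differentiable[OF _ \<open>open T\<close>] by blast
  have "Ck_on k (partial_deriv i (\<lambda>y. F (\<phi> y))) S" for i
  proof (rule Ck_on_cong[OF \<open>open S\<close>])
    show "Ck_on k (\<lambda>y. \<Sum>a\<in>UNIV. partial_deriv a F (\<phi> y) * partial_deriv i (\<lambda>y. \<phi> y $ a) y) S"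
    proof (intro Ck_on_sum Ck_on_mult \<open>open S\<close>)
      fix a
      show "Ck_on k (\<lambda>y. partial_deriv a F (\<phi> y)) S"
        using Suc.IH[of "partial_deriv a F"] Suc.prems(1) Ck_on_Suc_lower[OF Suc.prems(2)] by simp
      show "Ck_on k (partial_deriv i (\<lambda>y. \<phi> y $ a)) S"
        using Suc.prems(2) by simp
    qed
    show "(\<Sum>a\<in>UNIV. partial_deriv a F (\<phi> y) * partial_deriv i (\<lambda>y. \<phi> y $ a) y) = partial_deriv i (\<lambda>y. F (\<phi> y)) y"
      if "y \<in> S" for y
      using that by (simp add: partial_deriv_chain d\<phi> dF assms(5))
  qed
  moreover have "(\<lambda>y. F (\<phi> y)) differentiable_on S"
    unfolding differentiable_on_eq_differentiable_at[OF \<open>open S\<close>] using d\<phi> dF assms(5)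
    by (auto intro: differentiable_compose_components)
  ultimately show ?case by simp
qed

section \<open>Smooth functions\<close>

lemma smooth_on_cong:
  "open S \<Longrightarrow> (\<And>y. y \<in> S \<Longrightarrow> F y = F' y) \<Longrightarrow> smooth_on S F \<Longrightarrow> smooth_on S F'"
  using Ck_on_cong unfolding smooth_on_def by metis

lemma smooth_on_subset: "smooth_on S F \<Longrightarrow> T \<subseteq> S \<Longrightarrow> smooth_on T F"
  using Ck_on_subset unfolding smooth_on_def by metis

lemma smooth_on_const [intro, simp]: "smooth_on S (\<lambda>y. c)"
  by (simp add: smooth_on_def Ck_on_const)

lemma smooth_on_add: "open S \<Longrightarrow> smooth_on S F \<Longrightarrow> smooth_on S H \<Longrightarrow> smooth_on S (\<lambda>y. F y + H y)"
  by (simp add: smooth_on_def Ck_on_add)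

lemma smooth_on_mult: "open S \<Longrightarrow> smooth_on S F \<Longrightarrow> smooth_on S H \<Longrightarrow> smooth_on S (\<lambda>y. F y * H y)"
  by (simp add: smooth_on_def Ck_on_mult)

lemma smooth_on_diff: "open S \<Longrightarrow> smooth_on S F \<Longrightarrow> smooth_on S H \<Longrightarrow> smooth_on S (\<lambda>y. F y - H y)"
  using smooth_on_add[of S F "\<lambda>y. (- 1) * H y"] by (simp add: smooth_on_mult[of S "\<lambda>_. - 1" H, simplified])

lemma smooth_on_inverse:
  "open S \<Longrightarrow> smooth_on S F \<Longrightarrow> (\<And>y. y \<in> S \<Longrightarrow> F y \<noteq> 0) \<Longrightarrow> smooth_on S (\<lambda>y. inverse (F y))"
  by (simp add: smooth_on_def Ck_on_inverse)

lemma smooth_on_sum: "open S \<Longrightarrow> (\<And>a. a \<in> I \<Longrightarrow> smooth_on S (F a)) \<Longrightarrow> smooth_on S (\<lambda>y. \<Sum>a\<in>I. F a y)"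
  by (simp add: smooth_on_def Ck_on_sum)

lemma smooth_on_prod: "open S \<Longrightarrow> (\<And>a. a \<in> I \<Longrightarrow> smooth_on S (F a)) \<Longrightarrow> smooth_on S (\<lambda>y. \<Prod>a\<in>I. F a y)"
  by (induction I rule: infinite_finite_induct) (auto intro: smooth_on_mult)

lemma smooth_on_compose:
  fixes \<phi> :: "real^'n::finite \<Rightarrow> real^'m::finite"
  assumes "open S" "open T" "smooth_on T F" "\<And>a. smooth_on S (\<lambda>y. \<phi> y $ a)" "\<And>y. y \<in> S \<Longrightarrow> \<phi> y \<in> T"
  shows "smooth_on S (\<lambda>y. F (\<phi> y))"
  using assms Ck_on_compose unfolding smooth_on_def by blast

lemma smooth_on_partial_deriv: "smooth_on S F \<Longrightarrow> smooth_on S (partial_deriv i F)"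
  unfolding smooth_on_def by (meson Ck_on.simps(2))

lemma smooth_on_differentiable: "smooth_on S F \<Longrightarrow> open S \<Longrightarrow> x \<in> S \<Longrightarrow> F differentiable (at x)"
  unfolding smooth_on_def using differentiable_on_eq_differentiable_at by (metis Ck_on.simps(2))

lemma smooth_on_continuous: "smooth_on S F \<Longrightarrow> continuous_on S F"
  unfolding smooth_on_def by (metis Ck_on.simps(1))

lemma smooth_on_component: "smooth_on S (\<lambda>y. y $ a)"
  unfolding smooth_on_def
proof
  have "partial_deriv i (\<lambda>y. y $ a) = (\<lambda>y. if a = i then 1 else 0)" for i :: 'a
    by (auto simp: partial_deriv_component)
  moreover have "(\<lambda>y. y $ a) differentiable_on S"
    by (intro differentiable_at_imp_differentiable_on) (simp add: bounded_linear_imp_differentiable bounded_linear_vec_nth)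
  ultimately show "Ck_on k (\<lambda>y. y $ a) S" for k
    by (cases k) (auto simp: Ck_on_const continuous_on_component)
qed

lemma matrix_inv_inverse:
  fixes G :: "real^'n::finite^'n"
  assumes "invertible G"
  shows "G ** matrix_inv G = mat 1" "matrix_inv G ** G = mat 1"
  using someI_ex[OF assms[unfolded invertible_def]] unfolding matrix_inv_def by auto

text \<open>By Cramer's rule the entries of the inverse are rational functions of the entries.\<close>

lemma smooth_on_matrix_inv:
  fixes G :: "real^'n::finite \<Rightarrow> real^'n^'n"
  assumes "open S" "\<And>i j. smooth_on S (\<lambda>y. G y $ i $ j)" "\<And>y. y \<in> S \<Longrightarrow> invertible (G y)"
  shows "smooth_on S (\<lambda>y. matrix_inv (G y) $ i $ j)"
proof -
  \<comment> \<open>\<open>M\<close> is \<open>G\<close> with column \<open>i\<close> replaced by the unit vector \<open>j\<close>, so \<open>det M\<close> is a cofactor of \<open>G\<close>.\<close>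
  define M where "M y = (\<chi> r c. if c = i then axis j 1 $ r else G y $ r $ c)" for y
  have det: "smooth_on S (\<lambda>y. det (H y))"
    if "\<And>i j. smooth_on S (\<lambda>y. H y $ i $ j)" for H :: "real^'n \<Rightarrow> real^'n^'n"
    unfolding det_def by (intro smooth_on_sum smooth_on_mult smooth_on_prod \<open>open S\<close> smooth_on_const that)
  have d0: "det (G y) \<noteq> 0" if "y \<in> S" for y
    using assms(3)[OF that] invertible_det_nz by blast
  have eq: "det (M y) * inverse (det (G y)) = matrix_inv (G y) $ i $ j" if "y \<in> S" for y
  proof -
    have "G y *v (matrix_inv (G y) *v axis j 1) = axis j 1"
      using matrix_inv_inverse(1)[OF assms(3)[OF that]] by (simp add: matrix_vector_mul_assoc)
    then have "matrix_inv (G y) *v axis j 1 =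
        (\<chi> k. det (\<chi> r c. if c = k then axis j 1 $ r else G y $ r $ c) / det (G y))"
      using cramer[OF d0[OF that]] by blast
    then have "(matrix_inv (G y) *v axis j 1) $ i = det (M y) / det (G y)"
      by (simp add: M_def)
    then show ?thesis
      by (simp add: matrix_vector_mult_basis column_def divide_inverse)
  qed
  have smooth: "smooth_on S (\<lambda>y. det (M y) * inverse (det (G y)))"
  proof (intro smooth_on_mult smooth_on_inverse det assms d0)
    show "smooth_on S (\<lambda>y. M y $ r $ c)" for r c
      using assms(2)[of r c] by (cases "c = i") (simp_all add: M_def)
  qed auto
  show ?thesis
    by (rule smooth_on_cong[OF \<open>open S\<close> eq smooth])
qed

section \<open>Symmetry of second partial derivatives\<close>

lemma partial_deriv_mean_value:
  fixes F :: "real^'n::finite \<Rightarrow> real"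
  assumes "h > 0" "\<And>t. 0 \<le> t \<Longrightarrow> t \<le> h \<Longrightarrow> F differentiable (at (x + t *\<^sub>R axis i 1))"
  obtains t where "0 < t" "t < h" "F (x + h *\<^sub>R axis i 1) - F x = h * partial_deriv i F (x + t *\<^sub>R axis i 1)"
proof -
  have D: "((\<lambda>t. F (x + t *\<^sub>R axis i 1)) has_real_derivative partial_deriv i F (x + t *\<^sub>R axis i 1)) (at t)"
    if "0 \<le> t" "t \<le> h" for t
  proof -
    let ?D = "frechet_derivative F (at (x + t *\<^sub>R axis i 1))"
    have F: "(F has_derivative ?D) (at (x + t *\<^sub>R axis i 1))"
      using assms(2)[OF that] frechet_derivative_works by blast
    have "((\<lambda>t. x + t *\<^sub>R axis i 1) has_derivative (\<lambda>s. s *\<^sub>R axis i 1)) (at t)"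
      by (auto intro!: derivative_eq_intros)
    from has_derivative_compose[OF this F]
    have "((\<lambda>t. F (x + t *\<^sub>R axis i 1)) has_derivative (\<lambda>s. ?D (s *\<^sub>R axis i 1))) (at t)" .
    moreover have "?D (s *\<^sub>R axis i 1) = partial_deriv i F (x + t *\<^sub>R axis i 1) * s" for s
      using linear_scale[OF has_derivative_linear[OF F]] by (simp add: partial_deriv_def)
    ultimately show ?thesis
      by (simp add: has_field_derivative_def)
  qed
  from MVT2[OF \<open>h > 0\<close>, of "\<lambda>t. F (x + t *\<^sub>R axis i 1)" "\<lambda>t. partial_deriv i F (x + t *\<^sub>R axis i 1)"] D
  show ?thesis using that by auto
qed

text \<open>
  The left-hand side is symmetric in \<open>i\<close> and \<open>j\<close> although the right-hand side need not be, which is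
  what forces the mixed derivatives to agree in the limit \<open>h \<rightarrow> 0\<close>.
\<close>

lemma second_difference_mean_value:
  fixes F :: "real^'n::finite \<Rightarrow> real"
  assumes "open S" "smooth_on S F" "h > 0" "cball x (2 * h) \<subseteq> S"
  obtains y where "y \<in> cball x (2 * h)"
    "F (x + h *\<^sub>R axis i 1 + h *\<^sub>R axis j 1) - F (x + h *\<^sub>R axis i 1) - F (x + h *\<^sub>R axis j 1) + F x
     = h * h * partial_deriv j (partial_deriv i F) y"
proof -
  have mem: "x + t *\<^sub>R axis i 1 + s *\<^sub>R axis j 1 \<in> cball x (2 * h)"
    if "0 \<le> t" "t \<le> h" "0 \<le> s" "s \<le> h" for t s
  proof -
    have "norm (t *\<^sub>R axis i 1 + s *\<^sub>R axis j 1 :: real^'n) \<le> t + s"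
      using that norm_triangle_ineq[of "t *\<^sub>R axis i 1 :: real^'n" "s *\<^sub>R axis j 1"] by simp
    moreover have "dist x (x + t *\<^sub>R axis i 1 + s *\<^sub>R axis j 1) = norm (t *\<^sub>R axis i 1 + s *\<^sub>R axis j 1 :: real^'n)"
      unfolding dist_norm by (subst norm_minus_commute) (simp add: algebra_simps)
    ultimately show ?thesis using that by simp
  qed
  have d: "H differentiable (at (x + t *\<^sub>R axis i 1 + s *\<^sub>R axis j 1))"
    if "0 \<le> t" "t \<le> h" "0 \<le> s" "s \<le> h" "smooth_on S H" for t s and H :: "real^'n \<Rightarrow> real"
    using smooth_on_differentiable[OF that(5) \<open>open S\<close>] mem[OF that(1-4)] assms(4) by blast
  have d2: "F differentiable (at (x + t *\<^sub>R axis i 1))" if "0 \<le> t" "t \<le> h" for t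
    using d[OF that, of 0 F] assms by simp
  have D1: "((\<lambda>y. F (y + h *\<^sub>R axis j 1)) has_derivative
      frechet_derivative F (at (x + t *\<^sub>R axis i 1 + h *\<^sub>R axis j 1))) (at (x + t *\<^sub>R axis i 1))"
    if "0 \<le> t" "t \<le> h" for t
  proof -
    have "F differentiable (at (x + t *\<^sub>R axis i 1 + h *\<^sub>R axis j 1))"
      using d[OF that, of h F] assms by simp
    then have F: "(F has_derivative frechet_derivative F (at (x + t *\<^sub>R axis i 1 + h *\<^sub>R axis j 1)))
        (at (x + t *\<^sub>R axis i 1 + h *\<^sub>R axis j 1))"
      using frechet_derivative_works by blast
    have "((\<lambda>y. y + h *\<^sub>R axis j 1) has_derivative (\<lambda>y. y)) (at (x + t *\<^sub>R axis i 1))"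
      by (auto intro!: derivative_eq_intros)
    from has_derivative_compose[OF this F] show ?thesis .
  qed
  have d1: "(\<lambda>y. F (y + h *\<^sub>R axis j 1)) differentiable (at (x + t *\<^sub>R axis i 1))" if "0 \<le> t" "t \<le> h" for t
    using D1[OF that] differentiable_def by blast
  have p1: "partial_deriv i (\<lambda>y. F (y + h *\<^sub>R axis j 1)) (x + t *\<^sub>R axis i 1) =
     partial_deriv i F (x + t *\<^sub>R axis i 1 + h *\<^sub>R axis j 1)" if "0 \<le> t" "t \<le> h" for t
    using partial_deriv_eqI[OF D1[OF that], of i] by (simp only: partial_deriv_def)
  obtain t where t: "0 < t" "t < h" and
    "F (x + h *\<^sub>R axis i 1 + h *\<^sub>R axis j 1) - F (x + h *\<^sub>R axis i 1) - (F (x + h *\<^sub>R axis j 1) - F x)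
     = h * partial_deriv i (\<lambda>y. F (y + h *\<^sub>R axis j 1) - F y) (x + t *\<^sub>R axis i 1)"
    using partial_deriv_mean_value[of h "\<lambda>y. F (y + h *\<^sub>R axis j 1) - F y" x i, OF \<open>h > 0\<close> differentiable_diff[OF d1 d2]]
    by blast
  then have 1: "F (x + h *\<^sub>R axis i 1 + h *\<^sub>R axis j 1) - F (x + h *\<^sub>R axis i 1) - (F (x + h *\<^sub>R axis j 1) - F x)
     = h * (partial_deriv i F (x + t *\<^sub>R axis i 1 + h *\<^sub>R axis j 1) - partial_deriv i F (x + t *\<^sub>R axis i 1))"
    using p1 d1 d2 by (simp add: partial_deriv_diff)
  obtain s where s: "0 < s" "s < h" and
    2: "partial_deriv i F (x + t *\<^sub>R axis i 1 + h *\<^sub>R axis j 1) - partial_deriv i F (x + t *\<^sub>R axis i 1)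
     = h * partial_deriv j (partial_deriv i F) (x + t *\<^sub>R axis i 1 + s *\<^sub>R axis j 1)"
    using partial_deriv_mean_value[of h "partial_deriv i F" "x + t *\<^sub>R axis i 1" j, OF \<open>h > 0\<close>
        d[OF less_imp_le[OF t(1)] less_imp_le[OF t(2)] _ _ smooth_on_partial_deriv[OF assms(2)]]]
    by blast
  show ?thesis
    by (rule that[of "x + t *\<^sub>R axis i 1 + s *\<^sub>R axis j 1"]) (use mem t s 1 2 in auto)
qed

lemma partial_deriv_commute:
  fixes F :: "real^'n::finite \<Rightarrow> real"
  assumes "open S" "smooth_on S F" "x \<in> S"
  shows "partial_deriv i (partial_deriv j F) x = partial_deriv j (partial_deriv i F) x"
proof -
  obtain r where r: "r > 0" "cball x r \<subseteq> S"
    using assms open_contains_cball by blast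
  define h where "h n = (r / Suc n) / 2" for n :: nat
  have h: "h n > 0" "cball x (2 * h n) \<subseteq> S" for n
  proof -
    show "h n > 0" using r by (simp add: h_def)
    have "2 * h n \<le> r" using r by (simp add: h_def divide_le_eq mult_le_cancel_left1)
    then show "cball x (2 * h n) \<subseteq> S" using r by (meson order_trans subset_cball)
  qed
  let ?P = "\<lambda>i j n y. y \<in> cball x (2 * h n) \<and>
     F (x + h n *\<^sub>R axis i 1 + h n *\<^sub>R axis j 1) - F (x + h n *\<^sub>R axis i 1) - F (x + h n *\<^sub>R axis j 1) + F x
     = h n * h n * partial_deriv j (partial_deriv i F) y"
  have ex: "\<exists>y. \<forall>n. ?P i j n (y n)" for i j
  proof (intro choice allI)
    fix n
    show "\<exists>y. ?P i j n y"
      by (rule second_difference_mean_value[OF assms(1,2) h[of n], of i j]) blast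
  qed
  obtain y where y: "\<And>n. ?P i j n (y n)" using ex[of i j] by blast
  obtain z where z: "\<And>n. ?P j i n (z n)" using ex[of j i] by blast
  have eq: "partial_deriv j (partial_deriv i F) (y n) = partial_deriv i (partial_deriv j F) (z n)" for n
  proof -
    have "h n * h n * partial_deriv j (partial_deriv i F) (y n) = h n * h n * partial_deriv i (partial_deriv j F) (z n)"
      using y[of n] z[of n] by (simp add: algebra_simps)
    then show ?thesis using h(1)[of n] by (simp add: mult_left_cancel)
  qed
  have lim0: "(\<lambda>n. 2 * h n) \<longlonglongrightarrow> 0"
  proof -
    have "(\<lambda>n. 2 * h n) = (\<lambda>n. r / real (Suc n))"
      by (simp add: h_def fun_eq_iff field_simps)
    then show ?thesis
      using LIMSEQ_Suc[OF lim_const_over_n[of r]] by simp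
  qed
  have lim: "w \<longlonglongrightarrow> x" if "\<And>n. w n \<in> cball x (2 * h n)" for w
  proof -
    have "(\<lambda>n. dist (w n) x) \<longlonglongrightarrow> 0"
      by (rule tendsto_sandwich[OF _ _ tendsto_const lim0]) (use that in \<open>auto simp: dist_commute\<close>)
    then show ?thesis using tendsto_dist_iff by blast
  qed
  have cont: "isCont (partial_deriv a (partial_deriv b F)) x" for a b
    using smooth_on_continuous[OF smooth_on_partial_deriv[OF smooth_on_partial_deriv[OF assms(2)]]]
      assms continuous_on_eq_continuous_at by blast
  have "(\<lambda>n. partial_deriv j (partial_deriv i F) (y n)) \<longlonglongrightarrow> partial_deriv j (partial_deriv i F) x"
    using isCont_tendsto_compose[OF cont lim] y by blast
  moreover have "(\<lambda>n. partial_deriv j (partial_deriv i F) (y n)) \<longlonglongrightarrow> partial_deriv i (partial_deriv j F) x"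
    unfolding eq using isCont_tendsto_compose[OF cont lim] z by blast
  ultimately show ?thesis using LIMSEQ_unique by blast
qed

section \<open>Matrix algebra and matrix-valued functions\<close>

lemma mult_delta: "a * (if P then b else 0) = (if P then a * b else (0 :: real))"
  by simp

lemma delta_mult: "(if P then b else 0) * a = (if P then b * a else (0 :: real))"
  by simp

lemma matrix_diff_ldistrib: "A ** (B - C) = A ** B - A ** (C :: real^'n::finite^'m::finite)"
  by (vector matrix_matrix_mult_def sum_subtractf right_diff_distrib)

lemma matrix_diff_rdistrib: "(B - C) ** A = B ** A - C ** (A :: real^'n::finite^'m::finite)"
  by (vector matrix_matrix_mult_def sum_subtractf left_diff_distrib)

lemma matrix_add_rdistrib: "(B + C) ** A = B ** A + C ** (A :: real^'n::finite^'m::finite)"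
  by (vector matrix_matrix_mult_def sum.distrib distrib_right)

lemma matrix_sum_rdistrib:
  "(\<Sum>a\<in>I. M a) ** A = (\<Sum>a\<in>I. M a ** (A :: real^'n::finite^'m::finite))"
  by (induction I rule: infinite_finite_induct) (simp_all add: matrix_add_rdistrib)

lemma matrix_sum_ldistrib:
  "A ** (\<Sum>a\<in>I. M a) = (\<Sum>a\<in>I. A ** (M a :: real^'n::finite^'m::finite))"
  by (induction I rule: infinite_finite_induct) (simp_all add: matrix_add_ldistrib)

lemma matrix_scaleR_left: "(c *\<^sub>R A) ** B = c *\<^sub>R (A ** (B :: real^'n::finite^'m::finite))"
  by (vector matrix_matrix_mult_def sum_distrib_left mult.assoc)

lemma matrix_scaleR_right: "A ** (c *\<^sub>R B) = c *\<^sub>R (A ** (B :: real^'n::finite^'m::finite))"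
  by (vector matrix_matrix_mult_def sum_distrib_left mult.left_commute)

lemma transpose_add: "transpose (A + B) = transpose A + transpose (B :: real^'n::finite^'m::finite)"
  by (vector transpose_def)

lemma transpose_diff: "transpose (A - B) = transpose A - transpose (B :: real^'n::finite^'m::finite)"
  by (vector transpose_def)

lemma transpose_scaleR: "transpose (c *\<^sub>R A) = c *\<^sub>R transpose (A :: real^'n::finite^'m::finite)"
  by (vector transpose_def)

lemma transpose_sum: "transpose (\<Sum>a\<in>I. M a) = (\<Sum>a\<in>I. transpose (M a :: real^'n::finite^'m::finite))"
  by (simp add: transpose_def vec_eq_iff)

lemma matrix_left_cancel:
  fixes A B C :: "real^'n::finite^'n"
  assumes "invertible A" "A ** B = A ** C"
  shows "B = C"
  using assms(2) matrix_inv_inverse(2)[OF assms(1)]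
  by (metis matrix_mul_assoc matrix_mul_lid)

text \<open>
  Why contractions with the inverse metric do not depend on coordinates: the contraction is
  \<open>trace (G\<^sup>-\<^sup>1 U\<^sup>T)\<close>, and congruent pairs \<open>(G, U)\<close>, \<open>(H, V)\<close> give similar matrices \<open>G\<^sup>-\<^sup>1 U\<^sup>T\<close>, \<open>H\<^sup>-\<^sup>1 V\<^sup>T\<close>.
\<close>

lemma sum_contract_congruent:
  fixes G H J U V :: "real^'n::finite^'n"
  assumes "invertible G" and G: "G = transpose J ** H ** J" and U: "U = transpose J ** V ** J"
  shows "(\<Sum>i\<in>UNIV. \<Sum>j\<in>UNIV. matrix_inv G $ i $ j * U $ i $ j) =
         (\<Sum>i\<in>UNIV. \<Sum>j\<in>UNIV. matrix_inv H $ i $ j * V $ i $ j)"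
proof -
  have tr: "(\<Sum>i\<in>UNIV. \<Sum>j\<in>UNIV. M $ i $ j * W $ i $ j) = trace (M ** transpose W)"
    for M W :: "real^'n^'n"
    by (simp add: trace_def matrix_matrix_mult_def transpose_def)
  have det: "det G \<noteq> 0" using assms(1) invertible_det_nz by blast
  then have "invertible J" "invertible H"
    by (auto simp: G det_mul invertible_det_nz)
  define K L M where "K = matrix_inv J" and "L = matrix_inv H" and "M = matrix_inv G"
  have K: "J ** K = mat 1" "K ** J = mat 1" and L: "H ** L = mat 1"
    using matrix_inv_inverse \<open>invertible J\<close> \<open>invertible H\<close> unfolding K_def L_def by auto
  have Kt: "transpose J ** transpose K = mat 1"
    using K by (metis matrix_transpose_mul transpose_mat)
  have Kt2: "transpose K ** transpose J = mat 1"
    using K by (metis matrix_transpose_mul transpose_mat)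
  have "G ** (K ** L ** transpose K) = transpose J ** (H ** ((J ** K) ** L)) ** transpose K"
    by (simp add: G matrix_mul_assoc)
  also have "\<dots> = mat 1" by (simp add: K L Kt)
  also have "\<dots> = G ** M"
    using matrix_inv_inverse(1)[OF assms(1)] by (simp add: M_def)
  finally have M: "M = K ** L ** transpose K"
    using matrix_left_cancel[OF assms(1)] by metis
  have "M ** transpose U = K ** (L ** (transpose K ** transpose J) ** transpose V ** J)"
    by (simp add: M U matrix_transpose_mul matrix_mul_assoc)
  also have "\<dots> = K ** (L ** transpose V ** J)"
    by (simp add: Kt2)
  finally have "trace (M ** transpose U) = trace ((L ** transpose V ** J) ** K)"
    using trace_mul_sym[of K "L ** transpose V ** J"] by simp
  also have "(L ** transpose V ** J) ** K = L ** transpose V ** (J ** K)"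
    by (simp add: matrix_mul_assoc)
  finally show ?thesis by (simp add: tr K M_def L_def)
qed

definition matrix_partial ::
    "'n::finite \<Rightarrow> (real^'n \<Rightarrow> real^'m::finite^'k::finite) \<Rightarrow> real^'n \<Rightarrow> real^'m^'k" where
  "matrix_partial i M x = (\<chi> a b. partial_deriv i (\<lambda>y. M y $ a $ b) x)"

lemma matrix_partial_cong:
  assumes "open S" "x \<in> S" "\<And>y. y \<in> S \<Longrightarrow> M y = M' y"
  shows "matrix_partial i M x = matrix_partial i M' x"
proof -
  have "partial_deriv i (\<lambda>y. M y $ a $ b) x = partial_deriv i (\<lambda>y. M' y $ a $ b) x" for a b
    by (rule partial_deriv_cong[OF assms(1,2)]) (simp add: assms(3))
  then show ?thesis by (simp add: matrix_partial_def)
qed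

lemma matrix_partial_mult:
  fixes M :: "real^'n::finite \<Rightarrow> real^'m::finite^'k::finite" and N :: "real^'n \<Rightarrow> real^'l::finite^'m"
  assumes "\<And>a b. (\<lambda>y. M y $ a $ b) differentiable (at x)" "\<And>a b. (\<lambda>y. N y $ a $ b) differentiable (at x)"
  shows "matrix_partial i (\<lambda>y. M y ** N y) x = matrix_partial i M x ** N x + M x ** matrix_partial i N x"
  by (simp add: matrix_partial_def matrix_matrix_mult_def vec_eq_iff partial_deriv_sum partial_deriv_mult assms
      sum.distrib)

lemma matrix_partial_add:
  fixes M N :: "real^'n::finite \<Rightarrow> real^'m::finite^'k::finite"
  assumes "\<And>a b. (\<lambda>y. M y $ a $ b) differentiable (at x)" "\<And>a b. (\<lambda>y. N y $ a $ b) differentiable (at x)"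
  shows "matrix_partial i (\<lambda>y. M y + N y) x = matrix_partial i M x + matrix_partial i N x"
  by (simp add: matrix_partial_def vec_eq_iff partial_deriv_add assms)

lemma matrix_partial_transpose:
  "matrix_partial i (\<lambda>y. transpose (M y)) x = transpose (matrix_partial i M x)"
  by (simp add: matrix_partial_def vec_eq_iff transpose_def)

lemma matrix_partial_chain:
  fixes \<phi> :: "real^'n::finite \<Rightarrow> real^'n" and M :: "real^'n \<Rightarrow> real^'m::finite^'k::finite"
  assumes "\<And>a. (\<lambda>y. \<phi> y $ a) differentiable (at x)" "\<And>a b. (\<lambda>y. M y $ a $ b) differentiable (at (\<phi> x))"
  shows "matrix_partial i (\<lambda>y. M (\<phi> y)) x =
    (\<Sum>c\<in>UNIV. partial_deriv i (\<lambda>y. \<phi> y $ c) x *\<^sub>R matrix_partial c M (\<phi> x))"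
  by (simp add: matrix_partial_def vec_eq_iff partial_deriv_chain[OF assms(1) assms(2)] mult.commute)

lemma differentiable_matrix_mult:
  fixes M :: "real^'n::finite \<Rightarrow> real^'m::finite^'k::finite" and N :: "real^'n \<Rightarrow> real^'l::finite^'m"
  assumes "\<And>a b. (\<lambda>y. M y $ a $ b) differentiable (at x)" "\<And>a b. (\<lambda>y. N y $ a $ b) differentiable (at x)"
  shows "(\<lambda>y. (M y ** N y) $ a $ b) differentiable (at x)"
  by (simp add: matrix_matrix_mult_def assms)

section \<open>Metrics on coordinate domains\<close>

locale coordinate_metric =
  fixes S :: "(real^'n::finite) set" and G :: "real^'n \<Rightarrow> real^'n^'n"
  assumes open_domain: "open S"
    and smooth_metric: "\<And>i j. smooth_on S (\<lambda>x. G x $ i $ j)"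
    and metric_sym: "\<And>x i j. x \<in> S \<Longrightarrow> G x $ i $ j = G x $ j $ i"
    and metric_pos: "\<And>x v. x \<in> S \<Longrightarrow> v \<noteq> 0 \<Longrightarrow> v \<bullet> (G x *v v) > 0"
begin

lemma invertible_metric: "x \<in> S \<Longrightarrow> invertible (G x)"
  unfolding invertible_left_inverse matrix_left_invertible_ker
  using metric_pos[of x] by (metis inner_zero_right less_irrefl)

lemma transpose_metric: "x \<in> S \<Longrightarrow> transpose (G x) = G x"
  using metric_sym by (simp add: transpose_def vec_eq_iff)

lemma metric_times_inverse:
  assumes "x \<in> S"
  shows "(\<Sum>j\<in>UNIV. G x $ i $ j * matrix_inv (G x) $ j $ k) = (if i = k then 1 else 0)"
proof -
  have "(G x ** matrix_inv (G x)) $ i $ k = (if i = k then 1 else 0)"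
    by (simp add: matrix_inv_inverse(1)[OF invertible_metric[OF assms]] mat_def)
  then show ?thesis by (simp add: matrix_matrix_mult_def)
qed

lemma smooth_matrix_inv_metric: "smooth_on S (\<lambda>x. matrix_inv (G x) $ i $ j)"
  using smooth_on_matrix_inv open_domain smooth_metric invertible_metric by blast

lemma smooth_christoffel: "smooth_on S (christoffel G k i j)"
proof -
  have "smooth_on S (\<lambda>x. 1/2 * (\<Sum>l\<in>UNIV. matrix_inv (G x) $ k $ l *
        (partial_deriv i (\<lambda>y. G y $ j $ l) x + partial_deriv j (\<lambda>y. G y $ i $ l) x
         - partial_deriv l (\<lambda>y. G y $ i $ j) x)))"
    by (intro smooth_on_mult smooth_on_sum smooth_on_add smooth_on_diff smooth_on_const
        open_domain smooth_matrix_inv_metric smooth_on_partial_deriv smooth_metric)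
  then show ?thesis unfolding christoffel_def[abs_def] .
qed

lemma smooth_riemann_tensor: "smooth_on S (riemann_tensor G l i j k)"
  unfolding riemann_tensor_def[abs_def]
  by (intro smooth_on_mult smooth_on_sum smooth_on_add smooth_on_diff
      open_domain smooth_on_partial_deriv smooth_christoffel)

lemma smooth_coord_scalar_curvature: "smooth_on S (coord_scalar_curvature G)"
  unfolding coord_scalar_curvature_def[abs_def] ricci_tensor_def[abs_def]
  by (intro smooth_on_mult smooth_on_sum open_domain smooth_matrix_inv_metric smooth_riemann_tensor)

lemma metric_differentiable: "x \<in> S \<Longrightarrow> (\<lambda>y. G y $ i $ j) differentiable (at x)"
  using smooth_on_differentiable[OF smooth_metric open_domain] .

lemma christoffel_differentiable: "x \<in> S \<Longrightarrow> christoffel G k i j differentiable (at x)"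
  using smooth_on_differentiable[OF smooth_christoffel open_domain] .

lemma partial_deriv_metric_sym:
  "x \<in> S \<Longrightarrow> partial_deriv k (\<lambda>y. G y $ i $ j) x = partial_deriv k (\<lambda>y. G y $ j $ i) x"
  by (rule partial_deriv_cong[OF open_domain]) (simp_all add: metric_sym)

lemma christoffel_sym:
  assumes "x \<in> S"
  shows "christoffel G k i j x = christoffel G k j i x"
  using partial_deriv_metric_sym[OF assms, of _ i j]
  by (simp add: christoffel_def add.commute)

text \<open>Lowering the upper index removes the inverse matrix, so that derivatives of \<open>\<Gamma>\<close> can be found without differentiating it.\<close>

lemma metric_times_christoffel:
  assumes "x \<in> S"
  shows "(\<Sum>k\<in>UNIV. G x $ m $ k * christoffel G k i j x) =
    1/2 * (partial_deriv i (\<lambda>y. G y $ j $ m) x + partial_deriv j (\<lambda>y. G y $ i $ m) x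
         - partial_deriv m (\<lambda>y. G y $ i $ j) x)"
proof -
  define c where "c l = (partial_deriv i (\<lambda>y. G y $ j $ l) x + partial_deriv j (\<lambda>y. G y $ i $ l) x
         - partial_deriv l (\<lambda>y. G y $ i $ j) x)" for l
  have "(\<Sum>k\<in>UNIV. G x $ m $ k * christoffel G k i j x) =
      (\<Sum>k\<in>UNIV. \<Sum>l\<in>UNIV. 1/2 * (G x $ m $ k * matrix_inv (G x) $ k $ l * c l))"
    by (simp add: christoffel_def c_def sum_distrib_left mult_ac)
  also have "\<dots> = (\<Sum>l\<in>UNIV. 1/2 * ((\<Sum>k\<in>UNIV. G x $ m $ k * matrix_inv (G x) $ k $ l) * c l))"
    by (subst sum.swap) (simp add: sum_distrib_left sum_distrib_right)
  also have "\<dots> = 1/2 * c m"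
    by (simp add: metric_times_inverse[OF assms] if_distrib if_distribR cong: if_cong)
  finally show ?thesis by (simp add: c_def)
qed

text \<open>The metric is parallel for its Levi-Civita connection.\<close>

lemma metric_compatible:
  assumes "x \<in> S"
  shows "partial_deriv k (\<lambda>y. G y $ i $ j) x =
    (\<Sum>m\<in>UNIV. G x $ j $ m * christoffel G m k i x) + (\<Sum>m\<in>UNIV. G x $ i $ m * christoffel G m k j x)"
  unfolding metric_times_christoffel[OF assms]
  using partial_deriv_metric_sym[OF assms] by (simp add: field_simps)

text \<open>
  The matrix-valued connection form on the coordinate field \<open>\<partial>\<^sub>i\<close>.  In this form the curvature is
  \<open>dA + A \<and> A\<close>, and its behaviour under coordinate changes is a computation with noncommuting matrices
  instead of one with index sums.
\<close>

definition connection_matrix :: "'n \<Rightarrow> real^'n \<Rightarrow> real^'n^'n" where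
  "connection_matrix i x = (\<chi> l k. christoffel G l i k x)"

definition curvature_matrix :: "'n \<Rightarrow> 'n \<Rightarrow> real^'n \<Rightarrow> real^'n^'n" where
  "curvature_matrix i j x =
     matrix_partial i (connection_matrix j) x - matrix_partial j (connection_matrix i) x
     + connection_matrix i x ** connection_matrix j x - connection_matrix j x ** connection_matrix i x"

lemma curvature_matrix_component: "curvature_matrix i j x $ l $ k = riemann_tensor G l i j k x"
  by (simp add: curvature_matrix_def riemann_tensor_def matrix_partial_def connection_matrix_def
      matrix_matrix_mult_def sum_subtractf)

lemma connection_matrix_differentiable: "x \<in> S \<Longrightarrow> (\<lambda>y. connection_matrix i y $ a $ b) differentiable (at x)"
  using christoffel_differentiable by (simp add: connection_matrix_def)

lemma matrix_partial_metric:
  assumes "x \<in> S"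
  shows "matrix_partial k G x = transpose (G x ** connection_matrix k x) + G x ** connection_matrix k x"
  by (simp add: vec_eq_iff matrix_partial_def metric_compatible[OF assms] transpose_def
      matrix_matrix_mult_def connection_matrix_def)

end

lemma (in coordinate_metric) restrict_domain:
  assumes "open U" "U \<subseteq> S"
  shows "coordinate_metric U G"
  using assms smooth_metric metric_sym metric_pos
  by unfold_locales (auto intro: smooth_on_subset)

lemma coord_hessian_cong:
  assumes "open S" "x \<in> S" "\<And>y. y \<in> S \<Longrightarrow> F y = F' y"
  shows "coord_hessian G F i j x = coord_hessian G F' i j x"
proof -
  have 1: "partial_deriv k F y = partial_deriv k F' y" if "y \<in> S" for y k
    by (rule partial_deriv_cong[OF assms(1) that assms(3)])
  have "partial_deriv i (partial_deriv j F) x = partial_deriv i (partial_deriv j F') x"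
    by (rule partial_deriv_cong[OF assms(1,2) 1])
  then show ?thesis by (simp add: coord_hessian_def 1[OF assms(2)])
qed

lemma coord_hessian_diff_const:
  assumes "open S" "x \<in> S" "smooth_on S F"
  shows "coord_hessian G (\<lambda>y. F y - c) i j x = coord_hessian G F i j x"
proof -
  have 1: "partial_deriv k (\<lambda>y. F y - c) y = partial_deriv k F y" if "y \<in> S" for y k
    using smooth_on_differentiable[OF assms(3,1) that] by (simp add: partial_deriv_diff)
  have "partial_deriv i (partial_deriv j (\<lambda>y. F y - c)) x = partial_deriv i (partial_deriv j F) x"
    by (rule partial_deriv_cong[OF assms(1,2) 1])
  then show ?thesis by (simp add: coord_hessian_def 1[OF assms(2)])
qed

section \<open>Change of coordinates\<close>

definition jacobian_matrix :: "(real^'n::finite \<Rightarrow> real^'n) \<Rightarrow> real^'n \<Rightarrow> real^'n^'n" where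
  "jacobian_matrix \<phi> x = (\<chi> a i. partial_deriv i (\<lambda>y. \<phi> y $ a) x)"

text \<open>
  The algebraic core of the gauge covariance of curvature.  The first two hypotheses are the gauge law
  \<open>J A = dJ + B J\<close> in the directions \<open>i\<close> and \<open>j\<close>; the other two are its derivatives, with \<open>X\<close>, \<open>Y\<close> for the
  derivatives of \<open>A\<close>, \<open>B\<close> and a common term \<open>D\<close> because \<open>\<partial>\<^sub>i \<partial>\<^sub>j J\<close> is symmetric.  Eliminating \<open>dJ\<close>
  leaves \<open>J F\<^sub>A = F\<^sub>B J\<close>.
\<close>

lemma gauge_curvature:
  fixes J Ai Aj Bi Bj :: "real^'n::finite^'n"
  assumes i: "J ** Ai = Di + Bi ** J" and j: "J ** Aj = Dj + Bj ** J"
    and ij: "Di ** Aj + J ** Xij = D + (Yij ** J + Bj ** Di)"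
    and ji: "Dj ** Ai + J ** Xji = D + (Yji ** J + Bi ** Dj)"
  shows "J ** (Xij - Xji + Ai ** Aj - Aj ** Ai) = (Yij - Yji + Bi ** Bj - Bj ** Bi) ** J"
proof -
  have Di: "Di = J ** Ai - Bi ** J" and Dj: "Dj = J ** Aj - Bj ** J"
    using i j by auto
  have "J ** Xij = D + Yij ** J + Bj ** Di - Di ** Aj" "J ** Xji = D + Yji ** J + Bi ** Dj - Dj ** Ai"
    using ij ji by (auto simp: algebra_simps)
  then show ?thesis
    by (simp add: Di Dj matrix_add_ldistrib matrix_add_rdistrib matrix_diff_ldistrib
        matrix_diff_rdistrib matrix_mul_assoc)
qed

text \<open>
  A change of coordinates is described by the smooth map \<open>\<phi>\<close> in one direction only: it is a local
  diffeomorphism automatically, because \<open>G\<close> would be degenerate where the Jacobian matrix is singular.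
\<close>

locale metric_pullback = dom: coordinate_metric S G + cod: coordinate_metric T H
  for S T :: "(real^'n::finite) set" and G H +
  fixes \<phi> :: "real^'n \<Rightarrow> real^'n"
  assumes maps: "\<And>x. x \<in> S \<Longrightarrow> \<phi> x \<in> T"
    and smooth_map: "\<And>a. smooth_on S (\<lambda>x. \<phi> x $ a)"
    and pullback: "\<And>x. x \<in> S \<Longrightarrow> G x = transpose (jacobian_matrix \<phi> x) ** H (\<phi> x) ** jacobian_matrix \<phi> x"
begin

abbreviation "J \<equiv> jacobian_matrix \<phi>"

lemma map_differentiable: "x \<in> S \<Longrightarrow> (\<lambda>y. \<phi> y $ a) differentiable (at x)"
  using smooth_on_differentiable[OF smooth_map dom.open_domain] .

lemma smooth_jacobian: "smooth_on S (\<lambda>y. J y $ a $ i)"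
  using smooth_on_partial_deriv[OF smooth_map] by (simp add: jacobian_matrix_def)

lemma jacobian_differentiable: "x \<in> S \<Longrightarrow> (\<lambda>y. J y $ a $ i) differentiable (at x)"
  using smooth_on_differentiable[OF smooth_jacobian dom.open_domain] .

lemma invertible_jacobian:
  assumes "x \<in> S"
  shows "invertible (J x)"
  using dom.invertible_metric[OF assms]
  by (auto simp: pullback[OF assms] invertible_det_nz det_mul)

lemma partial_jacobian_sym:
  "x \<in> S \<Longrightarrow> matrix_partial i J x $ a $ k = matrix_partial k J x $ a $ i"
  using partial_deriv_commute[OF dom.open_domain smooth_map]
  by (simp add: matrix_partial_def jacobian_matrix_def)

text \<open>The pulled back connection form \<open>\<phi>\<^sup>* A'\<close> on \<open>\<partial>\<^sub>i\<close>, still expressed in the frame of the target coordinates.\<close>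

definition pulled_connection :: "'n \<Rightarrow> real^'n \<Rightarrow> real^'n^'n" where
  "pulled_connection i x = (\<Sum>b\<in>UNIV. J x $ b $ i *\<^sub>R cod.connection_matrix b (\<phi> x))"

lemma matrix_partial_pulled_metric:
  assumes "x \<in> S"
  shows "matrix_partial k (\<lambda>y. H (\<phi> y)) x =
    transpose (H (\<phi> x) ** pulled_connection k x) + H (\<phi> x) ** pulled_connection k x"
proof -
  have "matrix_partial k (\<lambda>y. H (\<phi> y)) x =
      (\<Sum>c\<in>UNIV. J x $ c $ k *\<^sub>R matrix_partial c H (\<phi> x))"
    by (simp add: matrix_partial_chain[OF map_differentiable[OF assms] cod.metric_differentiable[OF maps[OF assms]]]
        jacobian_matrix_def)
  then show ?thesis
    by (simp add: cod.matrix_partial_metric[OF maps[OF assms]] pulled_connection_def matrix_sum_ldistrib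
        transpose_sum transpose_scaleR matrix_scaleR_right scaleR_add_right sum.distrib)
qed

text \<open>
  This is the uniqueness of the Levi-Civita connection: both sides, lowered with the metric, are symmetric
  in the two lower indices of the Christoffel symbols (no torsion) and add up with their transposes to the
  derivative of \<open>G\<close> (metric compatibility).  Their difference \<open>E\<^sub>k\<^sub>i\<^sub>j\<close> is thus symmetric in \<open>k, j\<close> and antisymmetric in \<open>i, j\<close>,
  hence zero.
\<close>

lemma connection_transformation:
  assumes x: "x \<in> S"
  shows "J x ** dom.connection_matrix k x = matrix_partial k J x + pulled_connection k x ** J x"
proof -
  define P where "P k = matrix_partial k J x + pulled_connection k x ** J x" for k
  define E where "E k = transpose (J x) ** H (\<phi> x) ** P k - G x ** dom.connection_matrix k x" for k
  have P_sym: "P k $ a $ i = P i $ a $ k" for k i a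
  proof -
    have "(pulled_connection k x ** J x) $ a $ i =
       (\<Sum>c\<in>UNIV. \<Sum>b\<in>UNIV. J x $ b $ k * christoffel H a b c (\<phi> x) * J x $ c $ i)" for k i
      by (simp add: matrix_matrix_mult_def pulled_connection_def cod.connection_matrix_def sum_distrib_right)
    moreover have "(\<Sum>c\<in>UNIV. \<Sum>b\<in>UNIV. J x $ b $ k * christoffel H a b c (\<phi> x) * J x $ c $ i)
       = (\<Sum>c\<in>UNIV. \<Sum>b\<in>UNIV. J x $ b $ i * christoffel H a b c (\<phi> x) * J x $ c $ k)"
      using cod.christoffel_sym[OF maps[OF x], of a] by (subst sum.swap) (simp add: mult_ac)
    ultimately show ?thesis
      using partial_jacobian_sym[OF x] by (simp add: P_def)
  qed
  have E_sym: "E k $ i $ j = E j $ i $ k" for k i j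
    using P_sym dom.christoffel_sym[OF x]
    by (simp add: E_def matrix_matrix_mult_def dom.connection_matrix_def)
  have "matrix_partial k G x = matrix_partial k (\<lambda>y. transpose (J y) ** H (\<phi> y) ** J y) x" for k
    using matrix_partial_cong[OF dom.open_domain x pullback] .
  also have "\<dots> k = transpose (matrix_partial k J x) ** H (\<phi> x) ** J x
      + transpose (J x) ** (transpose (H (\<phi> x) ** pulled_connection k x) + H (\<phi> x) ** pulled_connection k x) ** J x
      + transpose (J x) ** H (\<phi> x) ** matrix_partial k J x" for k
  proof -
    have dJ: "(\<lambda>y. J y $ a $ i) differentiable (at x)" "(\<lambda>y. transpose (J y) $ a $ i) differentiable (at x)" for a i
      using jacobian_differentiable[OF x] by (simp_all add: transpose_def)
    have dH: "(\<lambda>y. H (\<phi> y) $ a $ b) differentiable (at x)" for a b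
      using differentiable_compose_components[OF map_differentiable[OF x] cod.metric_differentiable[OF maps[OF x]]] .
    show ?thesis
      by (simp add: matrix_partial_mult differentiable_matrix_mult dJ dH matrix_partial_transpose
          matrix_partial_pulled_metric[OF x] matrix_add_rdistrib add.assoc)
  qed
  finally have D: "matrix_partial k G x = transpose (matrix_partial k J x) ** H (\<phi> x) ** J x
      + transpose (J x) ** (transpose (H (\<phi> x) ** pulled_connection k x) + H (\<phi> x) ** pulled_connection k x) ** J x
      + transpose (J x) ** H (\<phi> x) ** matrix_partial k J x" for k .
  have E_anti: "transpose (E k) + E k = 0" for k
    using D[of k] dom.matrix_partial_metric[OF x, of k] cod.transpose_metric[OF maps[OF x]]
    by (simp add: E_def P_def transpose_diff transpose_add matrix_transpose_mul matrix_mul_assoc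
        matrix_add_ldistrib matrix_add_rdistrib algebra_simps)
  have E_anti': "E k $ i $ j = - E k $ j $ i" for k i j
    using arg_cong[OF E_anti[of k], of "\<lambda>M. M $ i $ j"] by (simp add: transpose_def)
  have "E k $ i $ j = 0" for k i j
  proof -
    have "E k $ i $ j = - E k $ j $ i" by (rule E_anti')
    also have "\<dots> = - E i $ j $ k" by (simp add: E_sym[of k j i])
    also have "\<dots> = E i $ k $ j" by (subst E_anti') simp
    also have "\<dots> = E j $ k $ i" by (rule E_sym)
    also have "\<dots> = - E j $ i $ k" by (rule E_anti')
    also have "\<dots> = - E k $ i $ j" by (simp add: E_sym[of k i j])
    finally show ?thesis by simp
  qed
  then have "E k = 0" by (simp add: vec_eq_iff)
  then have "(transpose (J x) ** H (\<phi> x)) ** P k = (transpose (J x) ** H (\<phi> x)) ** (J x ** dom.connection_matrix k x)"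
    by (simp add: E_def pullback[OF x] matrix_mul_assoc)
  moreover have "invertible (transpose (J x) ** H (\<phi> x))"
    using invertible_jacobian[OF x] cod.invertible_metric[OF maps[OF x]]
    by (simp add: invertible_det_nz det_mul)
  ultimately show ?thesis
    using matrix_left_cancel unfolding P_def by metis
qed

text \<open>
  Differentiating the gauge law.  In the derivative of the pulled back form the second derivatives of
  \<open>\<phi>\<close> are symmetric and cancel upon antisymmetrisation, which makes the result tensorial.
\<close>

lemma curvature_transformation:
  assumes x: "x \<in> S"
  shows "J x ** dom.curvature_matrix i j x =
    (\<Sum>c\<in>UNIV. \<Sum>b\<in>UNIV. (J x $ c $ i * J x $ b $ j) *\<^sub>R cod.curvature_matrix c b (\<phi> x)) ** J x"
proof -
  define Y where "Y i j = (\<Sum>b\<in>UNIV. matrix_partial i J x $ b $ j *\<^sub>R cod.connection_matrix b (\<phi> x)) +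
     (\<Sum>b\<in>UNIV. J x $ b $ j *\<^sub>R (\<Sum>c\<in>UNIV. J x $ c $ i *\<^sub>R matrix_partial c (cod.connection_matrix b) (\<phi> x)))" for i j
  have dA: "(\<lambda>y. cod.connection_matrix b (\<phi> y) $ r $ s) differentiable (at x)" for b r s
    using differentiable_compose_components[OF map_differentiable[OF x] cod.connection_matrix_differentiable[OF maps[OF x]]] .
  have Y: "matrix_partial i (pulled_connection j) x = Y i j" for i j
  proof -
    have chain: "(\<Sum>c\<in>UNIV. J x $ c $ i *\<^sub>R matrix_partial c (cod.connection_matrix b) (\<phi> x)) =
        matrix_partial i (\<lambda>y. cod.connection_matrix b (\<phi> y)) x" for b
      by (simp add: matrix_partial_chain[OF map_differentiable[OF x] cod.connection_matrix_differentiable[OF maps[OF x]]]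
        jacobian_matrix_def)
    show ?thesis
      unfolding Y_def chain
      by (simp add: vec_eq_iff pulled_connection_def matrix_partial_def partial_deriv_sum partial_deriv_mult
          jacobian_differentiable[OF x] dA sum.distrib)
  qed
  have dpull: "(\<lambda>y. pulled_connection j y $ r $ s) differentiable (at x)" for j r s
    by (simp add: pulled_connection_def jacobian_differentiable[OF x] dA)
  have ddJ: "(\<lambda>y. matrix_partial j J y $ a $ b) differentiable (at x)" for j a b
    using smooth_on_differentiable[OF smooth_on_partial_deriv[OF smooth_jacobian] dom.open_domain x]
    by (simp add: matrix_partial_def)
  have *: "matrix_partial i J x ** dom.connection_matrix j x + J x ** matrix_partial i (dom.connection_matrix j) x
      = matrix_partial i (matrix_partial j J) x + (Y i j ** J x + pulled_connection j x ** matrix_partial i J x)" for i j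
  proof -
    have "matrix_partial i J x ** dom.connection_matrix j x + J x ** matrix_partial i (dom.connection_matrix j) x
        = matrix_partial i (\<lambda>y. J y ** dom.connection_matrix j y) x"
      by (simp add: matrix_partial_mult jacobian_differentiable[OF x] dom.connection_matrix_differentiable[OF x])
    also have "\<dots> = matrix_partial i (\<lambda>y. matrix_partial j J y + pulled_connection j y ** J y) x"
      by (rule matrix_partial_cong[OF dom.open_domain x connection_transformation])
    also have "\<dots> = matrix_partial i (matrix_partial j J) x + (Y i j ** J x + pulled_connection j x ** matrix_partial i J x)"
      by (simp add: matrix_partial_add matrix_partial_mult ddJ dpull differentiable_matrix_mult
          jacobian_differentiable[OF x] Y)
    finally show ?thesis .
  qed
  have comm: "matrix_partial i (matrix_partial j J) x = matrix_partial j (matrix_partial i J) x"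
    using partial_deriv_commute[OF dom.open_domain smooth_jacobian x]
    by (simp add: matrix_partial_def)
  have "J x ** dom.curvature_matrix i j x = (Y i j - Y j i + pulled_connection i x ** pulled_connection j x
      - pulled_connection j x ** pulled_connection i x) ** J x"
    unfolding dom.curvature_matrix_def
    by (rule gauge_curvature[OF connection_transformation[OF x] connection_transformation[OF x] *])
      (use *[of j i] comm in simp)
  also have "Y i j - Y j i + pulled_connection i x ** pulled_connection j x
      - pulled_connection j x ** pulled_connection i x =
      (\<Sum>c\<in>UNIV. \<Sum>b\<in>UNIV. (J x $ c $ i * J x $ b $ j) *\<^sub>R cod.curvature_matrix c b (\<phi> x))"
  proof -
    let ?A = "\<lambda>b. cod.connection_matrix b (\<phi> x)" and ?D = "\<lambda>c b. matrix_partial c (cod.connection_matrix b) (\<phi> x)"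
    let ?S = "\<lambda>M. \<Sum>c\<in>UNIV. \<Sum>b\<in>UNIV. (J x $ c $ i * J x $ b $ j) *\<^sub>R (M c b :: real^'n^'n)"
    have "(\<Sum>b\<in>UNIV. J x $ b $ j *\<^sub>R (\<Sum>c\<in>UNIV. J x $ c $ i *\<^sub>R ?D c b)) = ?S (\<lambda>c b. ?D c b)"
      by (subst sum.swap) (simp add: scaleR_sum_right mult.commute)
    moreover have "(\<Sum>b\<in>UNIV. J x $ b $ i *\<^sub>R (\<Sum>c\<in>UNIV. J x $ c $ j *\<^sub>R ?D c b)) = ?S (\<lambda>c b. ?D b c)"
      by (simp add: scaleR_sum_right)
    moreover have "pulled_connection i x ** pulled_connection j x = ?S (\<lambda>c b. ?A c ** ?A b)"
      by (simp add: pulled_connection_def matrix_sum_ldistrib matrix_sum_rdistrib matrix_scaleR_left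
          matrix_scaleR_right scaleR_sum_right mult.commute)
        (subst sum.swap, simp add: mult.commute)
    moreover have "pulled_connection j x ** pulled_connection i x = ?S (\<lambda>c b. ?A b ** ?A c)"
      by (simp add: pulled_connection_def matrix_sum_ldistrib matrix_sum_rdistrib matrix_scaleR_left
          matrix_scaleR_right scaleR_sum_right mult.commute)
    ultimately show ?thesis
      using partial_jacobian_sym[OF x, of i _ j]
      by (simp add: Y_def cod.curvature_matrix_def scaleR_add_right scaleR_diff_right sum.distrib sum_subtractf)
  qed
  finally show ?thesis .
qed

text \<open>In the trace defining the Ricci tensor, the factor \<open>J\<^sup>-\<^sup>1\<close> of the raised index meets one of the factors \<open>J\<close>.\<close>

lemma ricci_transformation:
  assumes x: "x \<in> S"
  shows "(\<chi> j k. ricci_tensor G j k x) =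
    transpose (J x) ** (\<chi> b e. ricci_tensor H b e (\<phi> x)) ** J x"
proof -
  define K where "K = matrix_inv (J x)"
  have K: "K ** J x = mat 1" "J x ** K = mat 1"
    using matrix_inv_inverse[OF invertible_jacobian[OF x]] by (simp_all add: K_def)
  have JK: "(\<Sum>i\<in>UNIV. K $ i $ a * J x $ c $ i) = (if c = a then 1 else 0)" for a c
    using arg_cong[OF K(2), of "\<lambda>M. M $ c $ a"] by (simp add: matrix_matrix_mult_def mat_def mult.commute)
  have F: "dom.curvature_matrix i j x = K ** ((\<Sum>c\<in>UNIV. \<Sum>b\<in>UNIV. (J x $ c $ i * J x $ b $ j) *\<^sub>R
      cod.curvature_matrix c b (\<phi> x)) ** J x)" for i j
    by (metis K(1) curvature_transformation[OF x] matrix_mul_assoc matrix_mul_lid)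
  have "ricci_tensor G j k x = (transpose (J x) ** (\<chi> b e. ricci_tensor H b e (\<phi> x)) ** J x) $ j $ k" for j k
  proof -
    let ?R = "\<lambda>a c b e. riemann_tensor H a c b e (\<phi> x)"
    have "ricci_tensor G j k x = (\<Sum>i\<in>UNIV. dom.curvature_matrix i j x $ i $ k)"
      by (simp add: ricci_tensor_def dom.curvature_matrix_component)
    also have "\<dots> = (\<Sum>i\<in>UNIV. \<Sum>a\<in>UNIV. K $ i $ a * (\<Sum>e\<in>UNIV. (\<Sum>c\<in>UNIV. \<Sum>b\<in>UNIV.
        J x $ c $ i * J x $ b $ j * ?R a c b e) * J x $ e $ k))"
      by (simp add: F matrix_matrix_mult_def cod.curvature_matrix_component)
    also have "\<dots> = (\<Sum>i\<in>UNIV. \<Sum>a\<in>UNIV. \<Sum>e\<in>UNIV. \<Sum>c\<in>UNIV. K $ i $ a * J x $ c $ i *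
        (\<Sum>b\<in>UNIV. J x $ b $ j * ?R a c b e * J x $ e $ k))"
      by (simp add: sum_distrib_left sum_distrib_right mult_ac)
    also have "\<dots> = (\<Sum>a\<in>UNIV. \<Sum>e\<in>UNIV. \<Sum>c\<in>UNIV. \<Sum>i\<in>UNIV. K $ i $ a * J x $ c $ i *
        (\<Sum>b\<in>UNIV. J x $ b $ j * ?R a c b e * J x $ e $ k))"
      by (subst sum.swap, rule sum.cong[OF refl], subst sum.swap, rule sum.cong[OF refl], rule sum.swap)
    also have "\<dots> = (\<Sum>a\<in>UNIV. \<Sum>e\<in>UNIV. \<Sum>b\<in>UNIV. J x $ b $ j * ?R a a b e * J x $ e $ k)"
      by (simp add: JK flip: sum_distrib_right) (simp add: if_distribR if_distrib cong: if_cong)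
    also have "\<dots> = (\<Sum>e\<in>UNIV. \<Sum>b\<in>UNIV. \<Sum>a\<in>UNIV. J x $ b $ j * ?R a a b e * J x $ e $ k)"
      by (subst sum.swap, rule sum.cong[OF refl], rule sum.swap)
    also have "\<dots> = (transpose (J x) ** (\<chi> b e. ricci_tensor H b e (\<phi> x)) ** J x) $ j $ k"
      by (simp add: matrix_matrix_mult_def transpose_def ricci_tensor_def sum_distrib_left sum_distrib_right)
    finally show ?thesis .
  qed
  then show ?thesis by (simp add: vec_eq_iff)
qed

lemma contract_pullback:
  assumes x: "x \<in> S" and U: "(\<chi> i j. U i j) = transpose (J x) ** (\<chi> a b. V a b) ** J x"
  shows "(\<Sum>i\<in>UNIV. \<Sum>j\<in>UNIV. matrix_inv (G x) $ i $ j * U i j) =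
         (\<Sum>i\<in>UNIV. \<Sum>j\<in>UNIV. matrix_inv (H (\<phi> x)) $ i $ j * V i j)"
  using sum_contract_congruent[OF dom.invertible_metric[OF x] pullback[OF x] U] by simp

lemma scalar_curvature_invariant:
  "x \<in> S \<Longrightarrow> coord_scalar_curvature G x = coord_scalar_curvature H (\<phi> x)"
  unfolding coord_scalar_curvature_def by (rule contract_pullback[OF _ ricci_transformation])

lemma partial_deriv_pullback:
  assumes "x \<in> S" "F differentiable (at (\<phi> x))"
  shows "partial_deriv i (\<lambda>y. F (\<phi> y)) x = (\<Sum>a\<in>UNIV. partial_deriv a F (\<phi> x) * J x $ a $ i)"
  using partial_deriv_chain[OF map_differentiable[OF assms(1)] assms(2)] by (simp add: jacobian_matrix_def)

lemma inner_differentials_invariant: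
  assumes "x \<in> S" "F differentiable (at (\<phi> x))" "F' differentiable (at (\<phi> x))"
  shows "(\<Sum>i\<in>UNIV. \<Sum>j\<in>UNIV. matrix_inv (G x) $ i $ j *
            (partial_deriv i (\<lambda>y. F (\<phi> y)) x * partial_deriv j (\<lambda>y. F' (\<phi> y)) x)) =
         (\<Sum>i\<in>UNIV. \<Sum>j\<in>UNIV. matrix_inv (H (\<phi> x)) $ i $ j *
            (partial_deriv i F (\<phi> x) * partial_deriv j F' (\<phi> x)))"
proof (rule contract_pullback[OF assms(1)])
  show "(\<chi> i j. partial_deriv i (\<lambda>y. F (\<phi> y)) x * partial_deriv j (\<lambda>y. F' (\<phi> y)) x) =
    transpose (J x) ** (\<chi> a b. partial_deriv a F (\<phi> x) * partial_deriv b F' (\<phi> x)) ** J x"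
    by (simp add: vec_eq_iff partial_deriv_pullback assms matrix_matrix_mult_def transpose_def
        sum_distrib_left sum_distrib_right mult_ac)
qed

text \<open>
  The second derivatives of \<open>\<phi>\<close> that the chain rule creates are the inhomogeneous term in the
  transformation law of the Christoffel symbols.
\<close>

lemma hessian_transformation:
  assumes x: "x \<in> S" and F: "smooth_on T F"
  shows "(\<chi> i j. coord_hessian G (\<lambda>y. F (\<phi> y)) i j x) =
    transpose (J x) ** (\<chi> a b. coord_hessian H F a b (\<phi> x)) ** J x"
proof -
  let ?F = "\<lambda>a. partial_deriv a F (\<phi> x)" and ?FF = "\<lambda>b a. partial_deriv b (partial_deriv a F) (\<phi> x)"
  have dF: "F differentiable (at (\<phi> y))" "partial_deriv a F differentiable (at (\<phi> y))" if "y \<in> S" for y a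
    using smooth_on_differentiable[OF _ cod.open_domain maps[OF that]] F smooth_on_partial_deriv by blast+
  have dFc: "(\<lambda>y. partial_deriv a F (\<phi> y)) differentiable (at x)" for a
    using differentiable_compose_components[OF map_differentiable[OF x] dF(2)[OF x]] .
  have "coord_hessian G (\<lambda>y. F (\<phi> y)) i j x =
      (transpose (J x) ** (\<chi> a b. coord_hessian H F a b (\<phi> x)) ** J x) $ i $ j" for i j
  proof -
    have "partial_deriv i (partial_deriv j (\<lambda>y. F (\<phi> y))) x
        = partial_deriv i (\<lambda>y. \<Sum>a\<in>UNIV. partial_deriv a F (\<phi> y) * J y $ a $ j) x"
      by (rule partial_deriv_cong[OF dom.open_domain x]) (simp add: partial_deriv_pullback dF)
    also have "\<dots> = (\<Sum>a\<in>UNIV. (\<Sum>b\<in>UNIV. ?FF b a * J x $ b $ i) * J x $ a $ j)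
        + (\<Sum>a\<in>UNIV. ?F a * matrix_partial i J x $ a $ j)"
      by (simp add: partial_deriv_sum partial_deriv_mult dFc jacobian_differentiable[OF x]
          partial_deriv_pullback[OF x dF(2)[OF x]] matrix_partial_def sum.distrib)
    finally have 1: "partial_deriv i (partial_deriv j (\<lambda>y. F (\<phi> y))) x =
        (\<Sum>a\<in>UNIV. \<Sum>b\<in>UNIV. J x $ b $ i * ?FF b a * J x $ a $ j)
        + (\<Sum>a\<in>UNIV. ?F a * matrix_partial i J x $ a $ j)"
      by (simp add: sum_distrib_left sum_distrib_right mult_ac)
    have "(\<Sum>k\<in>UNIV. christoffel G k i j x * partial_deriv k (\<lambda>y. F (\<phi> y)) x)
        = (\<Sum>a\<in>UNIV. ?F a * (J x ** dom.connection_matrix i x) $ a $ j)"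
      by (simp add: partial_deriv_pullback[OF x dF(1)[OF x]] matrix_matrix_mult_def dom.connection_matrix_def
          sum_distrib_left mult_ac) (subst sum.swap, simp add: mult_ac)
    also have "\<dots> = (\<Sum>a\<in>UNIV. ?F a * matrix_partial i J x $ a $ j)
        + (\<Sum>a\<in>UNIV. ?F a * (pulled_connection i x ** J x) $ a $ j)"
      by (simp add: connection_transformation[OF x] distrib_left sum.distrib)
    also have "(\<Sum>a\<in>UNIV. ?F a * (pulled_connection i x ** J x) $ a $ j) =
        (\<Sum>e\<in>UNIV. \<Sum>c\<in>UNIV. \<Sum>b\<in>UNIV. J x $ b $ i * (christoffel H e b c (\<phi> x) * ?F e) * J x $ c $ j)"
      by (simp add: matrix_matrix_mult_def pulled_connection_def cod.connection_matrix_def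
          sum_distrib_left sum_distrib_right mult_ac)
    also have "\<dots> = (\<Sum>c\<in>UNIV. \<Sum>b\<in>UNIV. \<Sum>e\<in>UNIV. J x $ b $ i * (christoffel H e b c (\<phi> x) * ?F e) * J x $ c $ j)"
      by (subst sum.swap, rule sum.cong[OF refl], rule sum.swap)
    also have "\<dots> = (\<Sum>c\<in>UNIV. \<Sum>b\<in>UNIV. J x $ b $ i * (\<Sum>e\<in>UNIV. christoffel H e b c (\<phi> x) * ?F e) * J x $ c $ j)"
      by (simp add: sum_distrib_left sum_distrib_right)
    finally have 2: "(\<Sum>k\<in>UNIV. christoffel G k i j x * partial_deriv k (\<lambda>y. F (\<phi> y)) x) =
      (\<Sum>a\<in>UNIV. ?F a * matrix_partial i J x $ a $ j)
      + (\<Sum>c\<in>UNIV. \<Sum>b\<in>UNIV. J x $ b $ i * (\<Sum>e\<in>UNIV. christoffel H e b c (\<phi> x) * ?F e) * J x $ c $ j)" .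
    show ?thesis
      by (simp add: coord_hessian_def 1 2 matrix_matrix_mult_def transpose_def sum_distrib_right
          left_diff_distrib right_diff_distrib sum_subtractf)
  qed
  then show ?thesis by (simp add: vec_eq_iff)
qed

end

section \<open>Normal coordinates\<close>

text \<open>
  Gram-Schmidt in the form of an induction on the index set: a nonzero vector that is \<open>M\<close>-orthogonal to fewer than
  \<open>n\<close> given vectors exists for dimension reasons.
\<close>

lemma orthonormal_frame_exists:
  fixes M :: "real^'n::finite^'n"
  assumes sym: "transpose M = M" and pos: "\<And>v. v \<noteq> 0 \<Longrightarrow> v \<bullet> (M *v v) > 0"
  obtains V :: "real^'n^'n" where "transpose V ** M ** V = mat 1"
proof -
  have symm: "u \<bullet> (M *v w) = w \<bullet> (M *v u)" for u w
    using dot_lmul_matrix[of u M w] sym by (metis inner_commute transpose_matrix_vector)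
  have "\<exists>v::'n \<Rightarrow> real^'n. \<forall>i\<in>I. \<forall>j\<in>I. v i \<bullet> (M *v v j) = (if i = j then 1 else 0)" for I :: "'n set"
  proof (induction I rule: finite_induct[OF finite])
    case 1
    show ?case by simp
  next
    case (2 k I)
    then obtain v where v: "\<And>i j. i \<in> I \<Longrightarrow> j \<in> I \<Longrightarrow> v i \<bullet> (M *v v j) = (if i = j then 1 else 0)"
      by blast
    have "card I < CARD('n)"
      using 2 by (metis finite UNIV_I psubset_card_mono psubsetI subset_UNIV)
    then have "dim ((\<lambda>i. M *v v i) ` I) < DIM(real^'n)"
      using dim_le_card'[of "(\<lambda>i. M *v v i) ` I"] card_image_le[OF \<open>finite I\<close>, of "\<lambda>i. M *v v i"] by simp
    then obtain x where x: "x \<noteq> 0" "\<And>y. y \<in> span ((\<lambda>i. M *v v i) ` I) \<Longrightarrow> orthogonal x y"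
      using orthogonal_to_subspace_exists by metis
    have x0: "x \<bullet> (M *v v i) = 0" if "i \<in> I" for i
      using x(2)[OF span_base] that by (auto simp: orthogonal_def)
    define c where "c = x \<bullet> (M *v x)"
    have c: "c > 0" using pos[OF x(1)] by (simp add: c_def)
    define w where "w = (1 / sqrt c) *\<^sub>R x"
    have "w \<bullet> (M *v w) = (1 / sqrt c) * (1 / sqrt c) * c"
      by (simp add: w_def c_def matrix_vector_mult_scaleR)
    also have "\<dots> = 1" using c by (simp add: field_simps)
    finally have w1: "w \<bullet> (M *v w) = 1" .
    have w0: "w \<bullet> (M *v v i) = 0" "v i \<bullet> (M *v w) = 0" if "i \<in> I" for i
      using x0[OF that] symm by (simp_all add: w_def matrix_vector_mult_scaleR)
    show ?case
      by (rule exI[of _ "v(k := w)"]) (use \<open>k \<notin> I\<close> v w0 w1 in auto)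
  qed
  from this[of UNIV] obtain v :: "'n \<Rightarrow> real^'n" where
    v: "\<And>i j. v i \<bullet> (M *v v j) = (if i = j then 1 else 0)" by auto
  define V where "V = (\<chi> a i. v i $ a)"
  have "(transpose V ** (M ** V)) $ i $ j = v i \<bullet> (M *v v j)" for i j
    by (simp add: V_def matrix_matrix_mult_def transpose_def inner_vec_def matrix_vector_mult_def)
  then have "transpose V ** M ** V = mat 1"
    using v by (simp add: vec_eq_iff mat_def flip: matrix_mul_assoc)
  then show ?thesis using that by blast
qed

text \<open>
  The domain is cut down to where the Jacobian matrix is invertible rather than to a set on which the map is
  injective; the transformation laws ask for no more.
\<close>

lemma (in coordinate_metric) pulled_back_metric:
  fixes \<phi> :: "real^'n \<Rightarrow> real^'n"
  assumes smooth_\<phi>: "\<And>a. smooth_on UNIV (\<lambda>y. \<phi> y $ a)"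
  defines "D \<equiv> {y. \<phi> y \<in> S \<and> det (jacobian_matrix \<phi> y) \<noteq> 0}"
  shows "metric_pullback D S
    (\<lambda>y. transpose (jacobian_matrix \<phi> y) ** G (\<phi> y) ** jacobian_matrix \<phi> y) G \<phi>"
proof -
  let ?J = "jacobian_matrix \<phi>"
  have smooth_J: "smooth_on UNIV (\<lambda>y. ?J y $ a $ i)" for a i
    using smooth_on_partial_deriv[OF smooth_\<phi>] by (simp add: jacobian_matrix_def)
  have "continuous_on UNIV (\<lambda>y. \<chi> a. \<phi> y $ a)"
    by (intro continuous_on_vec_lambda smooth_on_continuous smooth_\<phi>)
  then have "open (\<phi> -` S)"
    using open_vimage[OF open_domain] by simp
  moreover have "continuous_on UNIV (\<lambda>y. det (?J y))"
    unfolding det_def by (intro continuous_intros smooth_on_continuous smooth_J)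
  then have "open ((\<lambda>y. det (?J y)) -` (- {0}))"
    using open_vimage by blast
  moreover have "D = \<phi> -` S \<inter> (\<lambda>y. det (?J y)) -` (- {0})"
    by (auto simp: D_def)
  ultimately have D: "open D" by auto
  have GD: "smooth_on D (\<lambda>y. G (\<phi> y) $ a $ b)" for a b
    by (rule smooth_on_compose[OF D open_domain smooth_metric]) (auto simp: D_def intro: smooth_on_subset[OF smooth_\<phi>])
  have JD: "smooth_on D (\<lambda>y. ?J y $ a $ i)" for a i
    using smooth_on_subset[OF smooth_J] by blast
  show ?thesis
  proof (unfold_locales)
    show "smooth_on D (\<lambda>y. (transpose (?J y) ** G (\<phi> y) ** ?J y) $ i $ j)" for i j
      unfolding matrix_matrix_mult_def transpose_def vec_lambda_beta
      by (intro smooth_on_sum smooth_on_mult D JD GD)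
    show "(transpose (?J y) ** G (\<phi> y) ** ?J y) $ i $ j = (transpose (?J y) ** G (\<phi> y) ** ?J y) $ j $ i"
      if "y \<in> D" for y i j
    proof -
      have "transpose (transpose (?J y) ** G (\<phi> y) ** ?J y) = transpose (?J y) ** G (\<phi> y) ** ?J y"
        using transpose_metric[of "\<phi> y"] that
        by (simp add: D_def matrix_transpose_mul matrix_mul_assoc)
      from arg_cong[OF this, of "\<lambda>M. M $ i $ j"] show ?thesis by (simp add: transpose_def)
    qed
    show "v \<bullet> ((transpose (?J y) ** G (\<phi> y) ** ?J y) *v v) > 0" if "y \<in> D" "v \<noteq> 0" for y v
    proof -
      have "invertible (?J y)" using that by (simp add: D_def invertible_det_nz)
      then have "?J y *v v \<noteq> 0"
        using that(2) matrix_left_invertible_ker[of "?J y"] invertible_left_inverse by blast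
      then have "(?J y *v v) \<bullet> (G (\<phi> y) *v (?J y *v v)) > 0"
        using metric_pos that by (simp add: D_def)
      moreover have "v \<bullet> ((transpose (?J y) ** G (\<phi> y) ** ?J y) *v v) = (?J y *v v) \<bullet> (G (\<phi> y) *v (?J y *v v))"
        using dot_lmul_matrix[of "G (\<phi> y) *v (?J y *v v)" "?J y" v]
        by (simp add: inner_commute flip: matrix_vector_mul_assoc)
      ultimately show ?thesis by simp
    qed
  qed (use D in \<open>auto simp: D_def intro: smooth_on_subset[OF smooth_\<phi>]\<close>)
qed

text \<open>
  The coordinate change is \<open>\<phi>(y) = p + V y - 1/2 \<Gamma>(p)(V y, V y)\<close>, where the columns of \<open>V\<close> are an orthonormal
  basis at \<open>p\<close>.  Its second derivative at \<open>0\<close> is chosen to cancel the other summand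
  in the transformation law of the connection.
\<close>

lemma (in coordinate_metric) normal_coordinates:
  assumes "p \<in> S"
  obtains D K \<phi> where "metric_pullback D S K G \<phi>" "0 \<in> D" "\<phi> 0 = p" "K 0 = mat 1"
    "\<And>k i j. christoffel K k i j 0 = 0"
proof -
  obtain V :: "real^'n^'n" where V: "transpose V ** G p ** V = mat 1"
    using orthonormal_frame_exists[OF transpose_metric[OF assms] metric_pos[OF assms]] .
  \<comment> \<open>\<open>w\<close> is the linear map \<open>V\<close>, and \<open>q\<close> carries the factor \<open>1/2\<close> of the quadratic term.\<close>
  define w where "w b y = (\<Sum>i\<in>UNIV. V $ b $ i * y $ i)" for b and y :: "real^'n"
  define q where "q a b c = 1/2 * christoffel G a b c p" for a b c
  define \<phi> where "\<phi> y = (\<chi> a. (p $ a + w a y) - (\<Sum>b\<in>UNIV. \<Sum>c\<in>UNIV. q a b c * (w b y * w c y)))" for y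
  have smooth_w: "smooth_on UNIV (w b)" for b
    unfolding w_def[abs_def] by (intro smooth_on_sum smooth_on_mult smooth_on_component) auto
  have dw: "w b differentiable (at y)" for b y
    using smooth_on_differentiable[OF smooth_w] by simp
  have pw: "partial_deriv i (w b) y = V $ b $ i" for i b y
  proof -
    have "(\<lambda>y. y $ j) differentiable (at y)" for j :: 'n
      using smooth_on_differentiable[OF smooth_on_component[of UNIV]] by simp
    then show ?thesis
      unfolding w_def[abs_def] by (simp add: partial_deriv_sum partial_deriv_cmult partial_deriv_component
        if_distrib cong: if_cong)
  qed
  have smooth_\<phi>: "smooth_on UNIV (\<lambda>y. \<phi> y $ a)" for a
    unfolding \<phi>_def vec_lambda_beta
    by (intro smooth_on_diff smooth_on_add smooth_on_sum smooth_on_mult smooth_w smooth_on_const open_UNIV)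
  have J: "jacobian_matrix \<phi> y $ a $ i =
      V $ a $ i - (\<Sum>b\<in>UNIV. \<Sum>c\<in>UNIV. q a b c * (V $ b $ i * w c y + w b y * V $ c $ i))" for y a i
    by (simp add: jacobian_matrix_def \<phi>_def partial_deriv_diff partial_deriv_add partial_deriv_cmult
        partial_deriv_sum partial_deriv_mult dw pw)
  have w0: "w b 0 = 0" for b by (simp add: w_def)
  have J0: "jacobian_matrix \<phi> 0 = V" by (simp add: vec_eq_iff J w0)
  have \<phi>0: "\<phi> 0 = p" by (simp add: \<phi>_def w0 vec_eq_iff)
  have dJ: "matrix_partial k (jacobian_matrix \<phi>) 0 $ a $ i =
      - (\<Sum>b\<in>UNIV. \<Sum>c\<in>UNIV. christoffel G a b c p * (V $ b $ k * V $ c $ i))"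
    for k a i
  proof -
    have "matrix_partial k (jacobian_matrix \<phi>) 0 $ a $ i =
      - (\<Sum>b\<in>UNIV. \<Sum>c\<in>UNIV. q a b c * (V $ b $ i * V $ c $ k + V $ b $ k * V $ c $ i))"
      by (simp add: matrix_partial_def J partial_deriv_diff partial_deriv_add partial_deriv_cmult
        partial_deriv_sum partial_deriv_mult dw pw)
    moreover have "(\<Sum>b\<in>UNIV. \<Sum>c\<in>UNIV. q a b c * (V $ b $ i * V $ c $ k)) =
        (\<Sum>b\<in>UNIV. \<Sum>c\<in>UNIV. q a b c * (V $ b $ k * V $ c $ i))"
      using christoffel_sym[OF assms, of a] by (subst sum.swap) (simp add: q_def mult_ac)
    ultimately show ?thesis
      by (simp add: distrib_left sum.distrib) (simp add: q_def flip: sum_divide_distrib)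
  qed
  define D where "D = {y. \<phi> y \<in> S \<and> det (jacobian_matrix \<phi> y) \<noteq> 0}"
  define K where "K y = transpose (jacobian_matrix \<phi> y) ** G (\<phi> y) ** jacobian_matrix \<phi> y" for y
  have K0: "K 0 = mat 1" by (simp add: K_def J0 \<phi>0 V)
  have "det (transpose V ** G p ** V) = 1" by (simp add: V)
  then have "det V \<noteq> 0" by (auto simp: det_mul)
  then have D0: "0 \<in> D" by (simp add: D_def \<phi>0 J0 assms)
  have pull: "metric_pullback D S K G \<phi>"
    using pulled_back_metric[OF smooth_\<phi>] unfolding D_def K_def[abs_def] .
  then interpret P: metric_pullback D S K G \<phi> .
  have "matrix_partial k (jacobian_matrix \<phi>) 0 + P.pulled_connection k 0 ** V = 0" for k
    by (simp add: vec_eq_iff dJ matrix_matrix_mult_def P.pulled_connection_def J0 \<phi>0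
        connection_matrix_def sum_distrib_left mult_ac)
      (subst sum.swap, simp add: mult_ac)
  then have "V ** P.dom.connection_matrix k 0 = V ** 0" for k
    using P.connection_transformation[OF D0, of k] by (simp add: J0)
  moreover have "invertible V" using \<open>det V \<noteq> 0\<close> by (simp add: invertible_det_nz)
  ultimately have "P.dom.connection_matrix k 0 = 0" for k
    using matrix_left_cancel by blast
  then have "christoffel K k i j 0 = 0" for k i j
    by (simp add: P.dom.connection_matrix_def vec_eq_iff)
  then show ?thesis using that pull D0 \<phi>0 K0 by blast
qed

section \<open>The identity at the origin of normal coordinates\<close>

lemma second_partial_sum:
  assumes "open S" "x \<in> S" "\<And>a. a \<in> I \<Longrightarrow> smooth_on S (F a)"
  shows "partial_deriv i (partial_deriv j (\<lambda>y. \<Sum>a\<in>I. F a y)) x = (\<Sum>a\<in>I. partial_deriv i (partial_deriv j (F a)) x)"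
proof -
  have "partial_deriv i (partial_deriv j (\<lambda>y. \<Sum>a\<in>I. F a y)) x = partial_deriv i (\<lambda>y. \<Sum>a\<in>I. partial_deriv j (F a) y) x"
    by (rule partial_deriv_cong[OF assms(1,2)])
      (simp add: partial_deriv_sum smooth_on_differentiable[OF assms(3) assms(1)])
  then show ?thesis
    by (simp add: partial_deriv_sum smooth_on_differentiable[OF smooth_on_partial_deriv[OF assms(3)] assms(1,2)])
qed

lemma second_partial_mult:
  assumes "open S" "x \<in> S" "smooth_on S F" "smooth_on S H"
  shows "partial_deriv i (partial_deriv j (\<lambda>y. F y * H y)) x =
    partial_deriv i (partial_deriv j F) x * H x + partial_deriv j F x * partial_deriv i H x
    + partial_deriv i F x * partial_deriv j H x + F x * partial_deriv i (partial_deriv j H) x"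
proof -
  note d = smooth_on_differentiable[OF assms(3,1)] smooth_on_differentiable[OF assms(4,1)]
    smooth_on_differentiable[OF smooth_on_partial_deriv[OF assms(3)] assms(1)]
    smooth_on_differentiable[OF smooth_on_partial_deriv[OF assms(4)] assms(1)]
  have "partial_deriv i (partial_deriv j (\<lambda>y. F y * H y)) x =
      partial_deriv i (\<lambda>y. partial_deriv j F y * H y + F y * partial_deriv j H y) x"
    by (rule partial_deriv_cong[OF assms(1,2)]) (simp add: partial_deriv_mult d)
  then show ?thesis
    by (simp add: partial_deriv_add partial_deriv_mult d assms(2))
qed

text \<open>
  The contracted second Bianchi identity at the origin of normal coordinates.  There, \<open>t\<close> being the
  third derivatives of the metric, \<open>dd n m k i j\<close> is \<open>\<partial>\<^sub>n \<partial>\<^sub>m \<Gamma>\<^sup>k\<^sub>i\<^sub>j\<close>, the left-hand side is \<open>\<partial>\<^sub>l R\<close> and the sum on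
  the right is the divergence of the Ricci tensor.
\<close>

lemma contracted_third_derivatives:
  fixes t :: "'n::finite \<Rightarrow> 'n \<Rightarrow> 'n \<Rightarrow> 'n \<Rightarrow> 'n \<Rightarrow> real"
  assumes t12: "\<And>a b c i j. t a b c i j = t b a c i j" and t23: "\<And>a b c i j. t a b c i j = t a c b i j"
    and t45: "\<And>a b c i j. t a b c i j = t a b c j i"
  defines "dd n m k i j \<equiv> 1/2 * (t n m i j k + t n m j i k - t n m k i j)"
  shows "(\<Sum>i\<in>UNIV. \<Sum>j\<in>UNIV. dd l i i j j - dd l j i i j) =
         2 * (\<Sum>i\<in>UNIV. \<Sum>j\<in>UNIV. dd i i l j j - dd i j l i j)"
proof -
  let ?S = "\<lambda>F. \<Sum>i\<in>UNIV. \<Sum>j\<in>(UNIV :: 'n set). (F i j :: real)"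
  have e1: "dd l i i j j - dd l j i i j = t i j l i j - 1/2 * t l i i j j - 1/2 * t l j j i i" for i j
    unfolding dd_def by (simp add: t12 t23 t45 field_simps)
  have e2: "2 * (dd i i l j j - dd i j l i j) = 2 * t i i j j l - t l i i j j - t i i j j l - t j j i i l + t i j l i j" for i j
    unfolding dd_def by (simp add: t12 t23 t45 field_simps)
  have "?S (\<lambda>i j. t l j j i i) = ?S (\<lambda>i j. t l i i j j)" "?S (\<lambda>i j. t j j i i l) = ?S (\<lambda>i j. t i i j j l)"
    by (rule sum.swap)+
  moreover have "?S (\<lambda>i j. dd l i i j j - dd l j i i j) =
      ?S (\<lambda>i j. t i j l i j) - 1/2 * ?S (\<lambda>i j. t l i i j j) - 1/2 * ?S (\<lambda>i j. t l j j i i)"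
    unfolding e1 by (simp add: sum_subtractf sum_distrib_left)
  moreover have "2 * ?S (\<lambda>i j. dd i i l j j - dd i j l i j) =
      2 * ?S (\<lambda>i j. t i i j j l) - ?S (\<lambda>i j. t l i i j j) - ?S (\<lambda>i j. t i i j j l)
      - ?S (\<lambda>i j. t j j i i l) + ?S (\<lambda>i j. t i j l i j)"
    unfolding sum_distrib_left e2 by (simp add: sum.distrib sum_subtractf sum_distrib_left)
  ultimately show ?thesis by simp
qed

context coordinate_metric
begin

text \<open>
  From here on \<open>x\<close> is the origin of a normal coordinate system.  The first derivatives of the metric and of
  its inverse vanish at \<open>x\<close>, so only the top order terms survive when the Christoffel symbols and the
  scalar curvature are differentiated there.
\<close>

context
  fixes x :: "real^'n"
  assumes x: "x \<in> S" and metric_id: "G x = mat 1" and christoffel_zero: "\<And>k i j. christoffel G k i j x = 0"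
begin

lemma partial_metric_zero: "partial_deriv k (\<lambda>y. G y $ i $ j) x = 0"
  by (simp add: metric_compatible[OF x] christoffel_zero)

lemma matrix_inv_metric_id: "matrix_inv (G x) = mat 1"
  using matrix_inv_inverse(1)[OF invertible_metric[OF x]] by (simp add: metric_id)

lemma partial_inverse_metric_zero: "partial_deriv k (\<lambda>y. matrix_inv (G y) $ i $ j) x = 0"
proof -
  have d: "(\<lambda>y. G y $ i $ j) differentiable (at x)" "(\<lambda>y. matrix_inv (G y) $ i $ j) differentiable (at x)" for i j
    using metric_differentiable[OF x] smooth_on_differentiable[OF smooth_matrix_inv_metric open_domain x] by auto
  have "matrix_partial k (\<lambda>y. G y ** matrix_inv (G y)) x = matrix_partial k (\<lambda>y. mat 1 :: real^'n^'n) x"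
    by (rule matrix_partial_cong[OF open_domain x]) (simp add: matrix_inv_inverse(1)[OF invertible_metric])
  also have "\<dots> = 0" by (simp add: matrix_partial_def vec_eq_iff)
  finally have "matrix_partial k G x ** matrix_inv (G x) + G x ** matrix_partial k (\<lambda>y. matrix_inv (G y)) x = 0"
    by (simp add: matrix_partial_mult d)
  moreover have "matrix_partial k G x = 0"
    by (simp add: matrix_partial_def vec_eq_iff partial_metric_zero)
  ultimately have "matrix_partial k (\<lambda>y. matrix_inv (G y)) x = 0"
    by (simp add: metric_id)
  then show ?thesis by (simp add: matrix_partial_def vec_eq_iff)
qed

definition metric2 :: "'n \<Rightarrow> 'n \<Rightarrow> 'n \<Rightarrow> 'n \<Rightarrow> real" where
  "metric2 k l i j = partial_deriv k (partial_deriv l (\<lambda>y. G y $ i $ j)) x"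

definition metric3 :: "'n \<Rightarrow> 'n \<Rightarrow> 'n \<Rightarrow> 'n \<Rightarrow> 'n \<Rightarrow> real" where
  "metric3 m k l i j = partial_deriv m (partial_deriv k (partial_deriv l (\<lambda>y. G y $ i $ j))) x"

lemma metric2_sym: "metric2 k l i j = metric2 l k i j" "metric2 k l i j = metric2 k l j i"
proof -
  show "metric2 k l i j = metric2 l k i j"
    unfolding metric2_def by (rule partial_deriv_commute[OF open_domain smooth_metric x])
  show "metric2 k l i j = metric2 k l j i"
    unfolding metric2_def by (rule partial_deriv_cong[OF open_domain x partial_deriv_metric_sym])
qed

lemma metric3_sym: "metric3 m k l i j = metric3 k m l i j" "metric3 m k l i j = metric3 m l k i j"
  "metric3 m k l i j = metric3 m k l j i"
proof -
  show "metric3 m k l i j = metric3 k m l i j"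
    unfolding metric3_def
    by (rule partial_deriv_commute[OF open_domain smooth_on_partial_deriv[OF smooth_metric] x])
  show "metric3 m k l i j = metric3 m l k i j"
    unfolding metric3_def
    by (rule partial_deriv_cong[OF open_domain x partial_deriv_commute[OF open_domain smooth_metric]])
  show "metric3 m k l i j = metric3 m k l j i"
    unfolding metric3_def
    by (rule partial_deriv_cong[OF open_domain x])
      (rule partial_deriv_cong[OF open_domain _ partial_deriv_metric_sym])
qed

text \<open>
  The values at \<open>x\<close> of \<open>\<partial>\<^sub>m \<Gamma>\<^sup>k\<^sub>i\<^sub>j\<close> and \<open>\<partial>\<^sub>n \<partial>\<^sub>m \<Gamma>\<^sup>k\<^sub>i\<^sub>j\<close> in terms of derivatives of the metric; see
  \<open>christoffel_partials_at_origin\<close>.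
\<close>

definition christoffel1 :: "'n \<Rightarrow> 'n \<Rightarrow> 'n \<Rightarrow> 'n \<Rightarrow> real" where
  "christoffel1 m k i j = 1/2 * (metric2 m i j k + metric2 m j i k - metric2 m k i j)"

definition christoffel2 :: "'n \<Rightarrow> 'n \<Rightarrow> 'n \<Rightarrow> 'n \<Rightarrow> 'n \<Rightarrow> real" where
  "christoffel2 n m k i j = 1/2 * (metric3 n m i j k + metric3 n m j i k - metric3 n m k i j)"

text \<open>
  Differentiating \<open>g\<^sub>k\<^sub>l \<Gamma>\<^sup>l\<^sub>i\<^sub>j = 1/2 (\<partial>\<^sub>i g\<^sub>j\<^sub>k + \<partial>\<^sub>j g\<^sub>i\<^sub>k - \<partial>\<^sub>k g\<^sub>i\<^sub>j)\<close>: on the left all derivatives fall on \<open>\<Gamma>\<close>,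
  since \<open>\<Gamma>\<close> and \<open>\<partial>g\<close> vanish at \<open>x\<close>.
\<close>

lemma christoffel_partials_at_origin:
  shows "partial_deriv m (christoffel G k i j) x = christoffel1 m k i j"
    and "partial_deriv n (partial_deriv m (christoffel G k i j)) x = christoffel2 n m k i j"
proof -
  let ?L = "\<lambda>y. \<Sum>l\<in>UNIV. G y $ k $ l * christoffel G l i j y"
  let ?R = "\<lambda>y. 1/2 * (partial_deriv i (\<lambda>y. G y $ j $ k) y + partial_deriv j (\<lambda>y. G y $ i $ k) y
         - partial_deriv k (\<lambda>y. G y $ i $ j) y)"
  note sm = smooth_metric smooth_on_partial_deriv[OF smooth_metric]
    smooth_on_partial_deriv[OF smooth_on_partial_deriv[OF smooth_metric]]
  note d = sm[THEN smooth_on_differentiable, OF open_domain]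
  have delta: "G x $ k $ l = (if k = l then 1 else 0)" for l
    by (simp add: metric_id mat_def)
  have R1: "partial_deriv m ?R y = 1/2 * (partial_deriv m (partial_deriv i (\<lambda>y. G y $ j $ k)) y
      + partial_deriv m (partial_deriv j (\<lambda>y. G y $ i $ k)) y
         - partial_deriv m (partial_deriv k (\<lambda>y. G y $ i $ j)) y)" if "y \<in> S" for m y
    by (subst partial_deriv_cmult) (simp_all add: partial_deriv_diff partial_deriv_add d that)
  have eq: "?L y = ?R y" if "y \<in> S" for y
    using metric_times_christoffel[OF that] .
  have "partial_deriv m ?L x = partial_deriv m ?R x"
    by (rule partial_deriv_cong[OF open_domain x eq])
  moreover have "partial_deriv m ?L x = partial_deriv m (christoffel G k i j) x"
    by (simp add: partial_deriv_sum partial_deriv_mult d x christoffel_differentiable christoffel_zero delta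
        delta_mult)
  ultimately have "partial_deriv m (christoffel G k i j) x = partial_deriv m ?R x"
    by (simp only:)
  then show "partial_deriv m (christoffel G k i j) x = christoffel1 m k i j"
    unfolding R1[OF x] christoffel1_def metric2_def .
  have "partial_deriv n (partial_deriv m ?L) x = partial_deriv n (partial_deriv m ?R) x"
    by (rule partial_deriv_cong[OF open_domain x], rule partial_deriv_cong[OF open_domain _ eq])
  moreover have "partial_deriv n (partial_deriv m ?R) x = partial_deriv n (\<lambda>y.
      1/2 * (partial_deriv m (partial_deriv i (\<lambda>y. G y $ j $ k)) y
      + partial_deriv m (partial_deriv j (\<lambda>y. G y $ i $ k)) y
         - partial_deriv m (partial_deriv k (\<lambda>y. G y $ i $ j)) y)) x"
    by (rule partial_deriv_cong[OF open_domain x R1])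
  moreover have "\<dots> = christoffel2 n m k i j"
    by (subst partial_deriv_cmult)
      (simp_all add: partial_deriv_diff partial_deriv_add d x christoffel2_def metric3_def)
  moreover have "partial_deriv n (partial_deriv m ?L) x = partial_deriv n (partial_deriv m (christoffel G k i j)) x"
    by (subst second_partial_sum[OF open_domain x smooth_on_mult[OF open_domain smooth_metric smooth_christoffel]])
      (simp add: second_partial_mult[OF open_domain x smooth_metric smooth_christoffel] christoffel_zero
        partial_metric_zero delta delta_mult)
  ultimately show "partial_deriv n (partial_deriv m (christoffel G k i j)) x = christoffel2 n m k i j"
    by (simp only:)
qed

lemma contract_at_origin:
  "(\<Sum>i\<in>UNIV. \<Sum>j\<in>UNIV. matrix_inv (G x) $ i $ j * U i j) = (\<Sum>i\<in>UNIV. U i i)"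
  by (simp add: matrix_inv_metric_id mat_def delta_mult)

lemma scalar_curvature_at_origin:
  "coord_scalar_curvature G x = (\<Sum>i\<in>UNIV. \<Sum>j\<in>UNIV. christoffel1 i i j j - christoffel1 j i i j)"
  unfolding coord_scalar_curvature_def contract_at_origin
  by (simp add: ricci_tensor_def riemann_tensor_def christoffel_zero christoffel_partials_at_origin) (rule sum.swap)

lemma partial_scalar_curvature_at_origin:
  "partial_deriv l (coord_scalar_curvature G) x =
    (\<Sum>i\<in>UNIV. \<Sum>j\<in>UNIV. christoffel2 l i i j j - christoffel2 l j i i j)"
proof -
  have dR: "riemann_tensor G l i j k differentiable (at x)" for l i j k
    using smooth_on_differentiable[OF smooth_riemann_tensor open_domain x] .
  have dRic: "ricci_tensor G j k differentiable (at x)" for j k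
    unfolding ricci_tensor_def[abs_def] by (simp add: dR)
  have dI: "(\<lambda>y. matrix_inv (G y) $ i $ j) differentiable (at x)" for i j
    using smooth_on_differentiable[OF smooth_matrix_inv_metric open_domain x] .
  have dC: "partial_deriv m (christoffel G k i j) differentiable (at x)" for m k i j
    using smooth_on_differentiable[OF smooth_on_partial_deriv[OF smooth_christoffel] open_domain x] .
  have R: "partial_deriv l (riemann_tensor G i i j k) x = christoffel2 l i i j k - christoffel2 l j i i k" for i j k
    unfolding riemann_tensor_def[abs_def]
    by (simp add: partial_deriv_add partial_deriv_diff partial_deriv_sum partial_deriv_mult dC
        christoffel_differentiable[OF x] christoffel_zero christoffel_partials_at_origin)
  have "partial_deriv l (coord_scalar_curvature G) x =
      (\<Sum>j\<in>UNIV. \<Sum>k\<in>UNIV. matrix_inv (G x) $ j $ k * partial_deriv l (ricci_tensor G j k) x)"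
    unfolding coord_scalar_curvature_def[abs_def]
    by (simp add: partial_deriv_sum partial_deriv_mult dRic dI partial_inverse_metric_zero)
  also have "\<dots> = (\<Sum>j\<in>UNIV. \<Sum>i\<in>UNIV. christoffel2 l i i j j - christoffel2 l j i i j)"
    unfolding contract_at_origin ricci_tensor_def[abs_def] by (simp add: partial_deriv_sum dR R)
  also have "\<dots> = (\<Sum>i\<in>UNIV. \<Sum>j\<in>UNIV. christoffel2 l i i j j - christoffel2 l j i i j)"
    by (rule sum.swap)
  finally show ?thesis .
qed

text \<open>
  The case \<open>m = i\<close>, \<open>j = k\<close> of the equality of \<open>\<partial>\<^sub>m \<partial>\<^sub>i \<partial>\<^sub>j \<partial>\<^sub>k f\<close> and \<open>\<partial>\<^sub>m \<partial>\<^sub>j \<partial>\<^sub>i \<partial>\<^sub>k f\<close>, summed over \<open>i\<close> and \<open>j\<close>, after the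
  inner second derivatives of \<open>f\<close> have been replaced by \<open>\<Gamma>\<^sup>l\<^sub>j\<^sub>k \<partial>\<^sub>l f + s g\<^sub>j\<^sub>k\<close>.
\<close>

lemma conformal_gradient_at_origin:
  assumes f: "smooth_on S f" and s: "smooth_on S s"
    and hess: "\<And>y i j. y \<in> S \<Longrightarrow> coord_hessian G f i j y = s y * G y $ i $ j"
  shows "(real CARD('n) - 1) * (\<Sum>i\<in>UNIV. partial_deriv i (partial_deriv i s) x) =
    - (1/2 * (\<Sum>l\<in>UNIV. partial_deriv l (coord_scalar_curvature G) x * partial_deriv l f x)
       + coord_scalar_curvature G x * s x)"
proof -
  let ?f = "\<lambda>l. partial_deriv l f x" and ?s2 = "\<lambda>i j. partial_deriv i (partial_deriv j s) x"
  let ?\<delta> = "\<lambda>i j :: 'n. if i = j then 1 else 0 :: real"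
  note smf = smooth_on_partial_deriv[OF f]
  have G\<delta>: "G x $ i $ j = ?\<delta> i j" for i j by (simp add: metric_id mat_def)
  have hess': "partial_deriv j (partial_deriv k f) y =
      (\<Sum>l\<in>UNIV. christoffel G l j k y * partial_deriv l f y) + s y * G y $ j $ k" if "y \<in> S" for y j k
    using hess[OF that, of j k] by (simp add: coord_hessian_def)
  have f2: "partial_deriv i (partial_deriv l f) x = (if i = l then s x else 0)" for i l
    by (simp add: hess'[OF x] christoffel_zero G\<delta>)
  have f4: "partial_deriv m (partial_deriv i (partial_deriv j (partial_deriv k f))) x =
      (\<Sum>l\<in>UNIV. christoffel2 m i l j k * ?f l) + s x * christoffel1 i m j k + s x * christoffel1 m i j k
      + ?s2 m i * ?\<delta> j k + s x * metric2 m i j k" for m i j k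
  proof -
    let ?P = "\<lambda>l y. christoffel G l j k y * partial_deriv l f y" and ?Q = "\<lambda>y. s y * G y $ j $ k"
    have smP: "smooth_on S (?P l)" for l
      using smooth_on_mult[OF open_domain smooth_christoffel smf] .
    have smQ: "smooth_on S ?Q"
      using smooth_on_mult[OF open_domain s smooth_metric] .
    have "partial_deriv m (partial_deriv i (partial_deriv j (partial_deriv k f))) x =
        partial_deriv m (partial_deriv i (\<lambda>y. (\<Sum>l\<in>UNIV. ?P l y) + ?Q y)) x"
      by (rule partial_deriv_cong[OF open_domain x], rule partial_deriv_cong[OF open_domain _ hess'])
    also have "\<dots> = partial_deriv m (partial_deriv i (\<lambda>y. \<Sum>l\<in>UNIV. ?P l y)) x + partial_deriv m (partial_deriv i ?Q) x"
    proof -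
      note d = smooth_on_differentiable[OF smooth_on_sum[OF open_domain smP] open_domain]
        smooth_on_differentiable[OF smQ open_domain]
        smooth_on_differentiable[OF smooth_on_partial_deriv[OF smooth_on_sum[OF open_domain smP]] open_domain]
        smooth_on_differentiable[OF smooth_on_partial_deriv[OF smQ] open_domain]
      have "partial_deriv m (partial_deriv i (\<lambda>y. (\<Sum>l\<in>UNIV. ?P l y) + ?Q y)) x =
        partial_deriv m (\<lambda>y. partial_deriv i (\<lambda>y. \<Sum>l\<in>UNIV. ?P l y) y + partial_deriv i ?Q y) x"
        by (rule partial_deriv_cong[OF open_domain x]) (rule partial_deriv_add, (rule d; assumption)+)
      also have "\<dots> = partial_deriv m (partial_deriv i (\<lambda>y. \<Sum>l\<in>UNIV. ?P l y)) x + partial_deriv m (partial_deriv i ?Q) x"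
        by (rule partial_deriv_add; rule d[OF x])
      finally show ?thesis .
    qed
    also have "partial_deriv m (partial_deriv i (\<lambda>y. \<Sum>l\<in>UNIV. ?P l y)) x =
       (\<Sum>l\<in>UNIV. christoffel2 m i l j k * ?f l) + s x * christoffel1 i m j k + s x * christoffel1 m i j k"
      unfolding second_partial_sum[OF open_domain x smP]
        second_partial_mult[OF open_domain x smooth_christoffel smf]
      by (simp add: christoffel_partials_at_origin christoffel_zero f2 sum.distrib mult_delta delta_mult mult.commute)
    also have "partial_deriv m (partial_deriv i ?Q) x = ?s2 m i * ?\<delta> j k + s x * metric2 m i j k"
      by (simp add: second_partial_mult[OF open_domain x s smooth_metric] G\<delta> partial_metric_zero metric2_def)
    finally show ?thesis by (simp add: algebra_simps)
  qed
  \<comment> \<open>In \<open>f4\<close> the left-hand side is symmetric in \<open>i, j\<close>, the right-hand side not visibly so.\<close>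
  have comm: "partial_deriv m (partial_deriv i (partial_deriv j (partial_deriv k f))) x =
      partial_deriv m (partial_deriv j (partial_deriv i (partial_deriv k f))) x" for m i j k
    by (rule partial_deriv_cong[OF open_domain x partial_deriv_commute[OF open_domain smf]])
  have E: "0 = (\<Sum>l\<in>UNIV. (christoffel2 i i l j j - christoffel2 i j l i j) * ?f l)
      + s x * (2 * christoffel1 i i j j - christoffel1 j i i j - christoffel1 i j i j
         + metric2 i i j j - metric2 i j i j) + (?s2 i i - ?s2 i j * ?\<delta> i j)" for i j
    using comm[of i i j j] unfolding f4
    by (simp add: algebra_simps sum_subtractf)
  let ?S = "\<lambda>F. \<Sum>i\<in>UNIV. \<Sum>j\<in>(UNIV :: 'n set). (F i j :: real)"
  have "0 = ?S (\<lambda>i j. \<Sum>l\<in>UNIV. (christoffel2 i i l j j - christoffel2 i j l i j) * ?f l)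
      + s x * ?S (\<lambda>i j. 2 * christoffel1 i i j j - christoffel1 j i i j - christoffel1 i j i j
         + metric2 i i j j - metric2 i j i j)
      + ?S (\<lambda>i j. ?s2 i i - ?s2 i j * ?\<delta> i j)"
    unfolding sum_distrib_left sum.distrib[symmetric] E[symmetric] by simp
  moreover have "?S (\<lambda>i j. ?s2 i i - ?s2 i j * ?\<delta> i j) = (real CARD('n) - 1) * (\<Sum>i\<in>UNIV. ?s2 i i)"
    unfolding sum_subtractf mult_delta by (simp add: left_diff_distrib flip: sum_distrib_left)
  moreover have "?S (\<lambda>i j. 2 * christoffel1 i i j j - christoffel1 j i i j - christoffel1 i j i j
         + metric2 i i j j - metric2 i j i j) = coord_scalar_curvature G x"
  proof -
    have "2 * christoffel1 i i j j - christoffel1 j i i j - christoffel1 i j i j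
         + metric2 i i j j - metric2 i j i j = christoffel1 i i j j - christoffel1 j i i j" for i j
      by (simp add: christoffel1_def metric2_sym field_simps)
    then show ?thesis
      unfolding scalar_curvature_at_origin by (simp only:)
  qed
  moreover have "?S (\<lambda>i j. \<Sum>l\<in>UNIV. (christoffel2 i i l j j - christoffel2 i j l i j) * ?f l) =
      1/2 * (\<Sum>l\<in>UNIV. partial_deriv l (coord_scalar_curvature G) x * ?f l)"
  proof -
    have "partial_deriv l (coord_scalar_curvature G) x =
        2 * ?S (\<lambda>i j. christoffel2 i i l j j - christoffel2 i j l i j)" for l
      unfolding partial_scalar_curvature_at_origin christoffel2_def
      by (rule contracted_third_derivatives[OF metric3_sym])
    then have half: "1/2 * (partial_deriv l (coord_scalar_curvature G) x * ?f l) =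
        (\<Sum>i\<in>UNIV. \<Sum>j\<in>UNIV. (christoffel2 i i l j j - christoffel2 i j l i j) * ?f l)" for l
      by (simp add: sum_distrib_right)
    have "1/2 * (\<Sum>l\<in>UNIV. partial_deriv l (coord_scalar_curvature G) x * ?f l) =
        (\<Sum>l\<in>UNIV. \<Sum>i\<in>UNIV. \<Sum>j\<in>UNIV. (christoffel2 i i l j j - christoffel2 i j l i j) * ?f l)"
      unfolding sum_distrib_left half ..
    also have "\<dots> = (\<Sum>i\<in>UNIV. \<Sum>j\<in>UNIV. \<Sum>l\<in>UNIV. (christoffel2 i i l j j - christoffel2 i j l i j) * ?f l)"
      by (subst sum.swap, rule sum.cong[OF refl], rule sum.swap)
    finally show ?thesis by simp
  qed
  ultimately show ?thesis by (simp add: mult.commute)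
qed

end

text \<open>The computation at the origin, carried back to \<open>p\<close> by the invariance of each of its terms.\<close>

lemma conformal_gradient_identity:
  assumes p: "p \<in> S" and f: "smooth_on S f" and s: "smooth_on S s"
    and hess: "\<And>y i j. y \<in> S \<Longrightarrow> coord_hessian G f i j y = s y * G y $ i $ j"
  shows "(real CARD('n) - 1) * (\<Sum>i\<in>UNIV. \<Sum>j\<in>UNIV. matrix_inv (G p) $ i $ j * coord_hessian G s i j p) =
    - (1/2 * (\<Sum>i\<in>UNIV. \<Sum>j\<in>UNIV. matrix_inv (G p) $ i $ j *
          (partial_deriv i (coord_scalar_curvature G) p * partial_deriv j f p))
       + coord_scalar_curvature G p * s p)"
proof -
  obtain D K \<phi> where pull: "metric_pullback D S K G \<phi>" and D0: "0 \<in> D" and \<phi>0: "\<phi> 0 = p"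
    and K0: "K 0 = mat 1" and \<Gamma>0: "\<And>k i j. christoffel K k i j 0 = 0"
    using normal_coordinates[OF p] by blast
  interpret P: metric_pullback D S K G \<phi> by (rule pull)
  have smooth: "smooth_on D (\<lambda>y. F (\<phi> y))" if "smooth_on S F" for F
    by (rule smooth_on_compose[OF P.dom.open_domain open_domain that P.smooth_map P.maps])
  have diff: "F differentiable (at (\<phi> 0))" if "smooth_on S F" for F
    using smooth_on_differentiable[OF that open_domain] p by (simp add: \<phi>0)
  have hessK: "coord_hessian K (\<lambda>y. f (\<phi> y)) i j y = s (\<phi> y) * K y $ i $ j" if "y \<in> D" for y i j
  proof -
    have "(\<chi> a b. coord_hessian G f a b (\<phi> y)) = s (\<phi> y) *\<^sub>R G (\<phi> y)"
      using hess[OF P.maps[OF that]] by (simp add: vec_eq_iff)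
    then have "(\<chi> i j. coord_hessian K (\<lambda>y. f (\<phi> y)) i j y) = s (\<phi> y) *\<^sub>R K y"
      by (simp add: P.hessian_transformation[OF that f] P.pullback[OF that] matrix_scaleR_left matrix_scaleR_right)
    from arg_cong[OF this, of "\<lambda>M. M $ i $ j"] show ?thesis by simp
  qed
  have curv: "partial_deriv i (coord_scalar_curvature K) 0 = partial_deriv i (\<lambda>y. coord_scalar_curvature G (\<phi> y)) 0" for i
    by (rule partial_deriv_cong[OF P.dom.open_domain D0 P.scalar_curvature_invariant])
  note origin = P.dom.contract_at_origin[OF D0 K0 \<Gamma>0]
  have "(\<Sum>i\<in>UNIV. \<Sum>j\<in>UNIV. matrix_inv (G p) $ i $ j * coord_hessian G s i j p) =
      (\<Sum>i\<in>UNIV. \<Sum>j\<in>UNIV. matrix_inv (K 0) $ i $ j * coord_hessian K (\<lambda>y. s (\<phi> y)) i j 0)"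
    using P.contract_pullback[OF D0 P.hessian_transformation[OF D0 s]] by (simp add: \<phi>0)
  also have "\<dots> = (\<Sum>i\<in>UNIV. partial_deriv i (partial_deriv i (\<lambda>y. s (\<phi> y))) 0)"
    by (simp add: origin coord_hessian_def \<Gamma>0)
  finally have 1: "(\<Sum>i\<in>UNIV. \<Sum>j\<in>UNIV. matrix_inv (G p) $ i $ j * coord_hessian G s i j p) =
    (\<Sum>i\<in>UNIV. partial_deriv i (partial_deriv i (\<lambda>y. s (\<phi> y))) 0)" .
  have 2: "(\<Sum>i\<in>UNIV. \<Sum>j\<in>UNIV. matrix_inv (G p) $ i $ j *
          (partial_deriv i (coord_scalar_curvature G) p * partial_deriv j f p)) =
      (\<Sum>i\<in>UNIV. partial_deriv i (coord_scalar_curvature K) 0 * partial_deriv i (\<lambda>y. f (\<phi> y)) 0)"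
    using P.inner_differentials_invariant[OF D0 diff[OF smooth_coord_scalar_curvature] diff[OF f]]
    unfolding curv origin \<phi>0 by (rule sym)
  show ?thesis
    using P.dom.conformal_gradient_at_origin[OF D0 K0 \<Gamma>0 smooth[OF f] smooth[OF s] hessK]
    by (simp add: 1 2 P.scalar_curvature_invariant[OF D0] \<phi>0)
qed

end

section \<open>Charts and tangent vectors\<close>

locale smooth_structure =
  fixes X :: "'a topology" and A :: "('a, 'n::finite) chart set"
  assumes atlas: "smooth_atlas X A"
begin

lemma chart_is_chart: "c \<in> A \<Longrightarrow> is_chart X c"
  using atlas by (simp add: smooth_atlas_def)

lemma chart_openin: "c \<in> A \<Longrightarrow> openin X (fst c)"
  using chart_is_chart by (auto simp: is_chart_def)

lemma chart_subset: "c \<in> A \<Longrightarrow> fst c \<subseteq> topspace X"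
  using chart_openin openin_subset by blast

lemma chart_inj:
  assumes "c \<in> A"
  shows "inj_on (snd c) (fst c)"
proof -
  have "homeomorphic_map (subtopology X (fst c)) (top_of_set (snd c ` fst c)) (snd c)"
    using chart_is_chart[OF assms] by (simp add: is_chart_def)
  from homeomorphic_imp_injective_map[OF this] show ?thesis
    using chart_subset[OF assms] by (simp add: Int_absorb1)
qed

lemma chart_image_open:
  assumes "c \<in> A" "openin X U"
  shows "open (snd c ` (fst c \<inter> U))"
proof -
  have c: "homeomorphic_map (subtopology X (fst c)) (top_of_set (snd c ` fst c)) (snd c)" "open (snd c ` fst c)"
    using chart_is_chart[OF assms(1)] by (simp_all add: is_chart_def)
  have "openin (subtopology X (fst c)) (fst c \<inter> U)"
    using assms(2) by (auto simp: openin_subtopology)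
  then have "openin (top_of_set (snd c ` fst c)) (snd c ` (fst c \<inter> U))"
    using homeomorphic_imp_open_map[OF c(1)] by (simp add: open_map_def)
  then show ?thesis using openin_open_eq[OF c(2)] by blast
qed

lemma chart_range_open: "c \<in> A \<Longrightarrow> open (snd c ` fst c)"
  using chart_is_chart by (auto simp: is_chart_def)

lemma chart_inv_left: "c \<in> A \<Longrightarrow> q \<in> fst c \<Longrightarrow> chart_inv c (snd c q) = q"
  using chart_inj by (simp add: chart_inv_def)

lemma chart_at_mem:
  assumes "p \<in> topspace X"
  shows "chart_at A p \<in> A" "p \<in> fst (chart_at A p)"
proof -
  have "\<exists>c. c \<in> A \<and> p \<in> fst c"
    using assms atlas unfolding smooth_atlas_def by blast
  from someI_ex[OF this] show "chart_at A p \<in> A" "p \<in> fst (chart_at A p)"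
    by (auto simp: chart_at_def)
qed

lemma transition_smooth:
  "c \<in> A \<Longrightarrow> d \<in> A \<Longrightarrow> smooth_on (snd c ` (fst c \<inter> fst d)) (\<lambda>x. snd d (chart_inv c x) $ i)"
  using atlas by (simp add: smooth_atlas_def)

lemma smooth_near_const: "p \<in> topspace X \<Longrightarrow> smooth_near X A p (\<lambda>q. a)"
  unfolding smooth_near_def smooth_fun_on_def by (auto simp: o_def intro!: exI[of _ "topspace X"])

lemma smooth_near_coordinate:
  assumes "c \<in> A" "p \<in> fst c"
  shows "smooth_near X A p (\<lambda>q. snd c q $ a)"
  unfolding smooth_near_def smooth_fun_on_def
proof (intro exI[of _ "fst c"] conjI ballI)
  show "smooth_on (snd d ` (fst d \<inter> fst c)) ((\<lambda>q. snd c q $ a) \<circ> chart_inv d)" if "d \<in> A" for d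
    using transition_smooth[OF that assms(1), of a] by (simp add: o_def)
qed (use assms chart_openin in blast)+

lemma smooth_near_combine:
  assumes "smooth_near X A p F" "smooth_near X A p H"
    and comb: "\<And>(S :: (real^'n) set) F H. open S \<Longrightarrow> smooth_on S F \<Longrightarrow> smooth_on S H \<Longrightarrow> smooth_on S (\<lambda>y. b (F y) (H y))"
  shows "smooth_near X A p (\<lambda>q. b (F q) (H q))"
proof -
  obtain U V where U: "openin X U" "p \<in> U" "smooth_fun_on A U F" and V: "openin X V" "p \<in> V" "smooth_fun_on A V H"
    using assms(1,2) unfolding smooth_near_def by blast
  have "smooth_fun_on A (U \<inter> V) (\<lambda>q. b (F q) (H q))"
    unfolding smooth_fun_on_def
  proof
    fix c assume c: "c \<in> A"
    have "smooth_on (snd c ` (fst c \<inter> (U \<inter> V))) (F \<circ> chart_inv c)"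
      "smooth_on (snd c ` (fst c \<inter> (U \<inter> V))) (H \<circ> chart_inv c)"
      using U(3) V(3) c unfolding smooth_fun_on_def by (blast intro: smooth_on_subset)+
    from comb[OF chart_image_open[OF c openin_Int[OF U(1) V(1)]] this]
    show "smooth_on (snd c ` (fst c \<inter> (U \<inter> V))) ((\<lambda>q. b (F q) (H q)) \<circ> chart_inv c)"
      by (simp add: o_def)
  qed
  then show ?thesis
    unfolding smooth_near_def using U V by blast
qed

lemma smooth_near_add:
  "smooth_near X A p F \<Longrightarrow> smooth_near X A p H \<Longrightarrow> smooth_near X A p (\<lambda>q. F q + H q)"
  by (rule smooth_near_combine[where b = "(+)"]) (simp_all add: smooth_on_add)

lemma smooth_near_mult:
  "smooth_near X A p F \<Longrightarrow> smooth_near X A p H \<Longrightarrow> smooth_near X A p (\<lambda>q. F q * H q)"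
  by (rule smooth_near_combine[where b = "(*)"]) (simp_all add: smooth_on_mult)

lemma smooth_near_differentiable:
  assumes "smooth_near X A p F" "c \<in> A" "p \<in> fst c"
  shows "(F \<circ> chart_inv c) differentiable (at (snd c p))"
proof -
  obtain U where U: "openin X U" "p \<in> U" "smooth_fun_on A U F"
    using assms(1) unfolding smooth_near_def by blast
  show ?thesis
    by (rule smooth_on_differentiable[of "snd c ` (fst c \<inter> U)"])
      (use U assms chart_image_open in \<open>auto simp: smooth_fun_on_def\<close>)
qed

lemma coord_vector_tangent:
  assumes c: "c \<in> A" "p \<in> fst c"
  shows "coord_vector X A c p i \<in> tangent_space X A p"
proof -
  have p: "p \<in> topspace X" using assms chart_subset by blast
  have d: "(\<lambda>x. F (chart_inv c x)) differentiable (at (snd c p))" if "smooth_near X A p F" for F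
    using smooth_near_differentiable[OF that c] by (simp add: o_def)
  have cv: "coord_vector X A c p i F = partial_deriv i (\<lambda>x. F (chart_inv c x)) (snd c p)"
    if "smooth_near X A p F" for F
    using that by (simp add: coord_vector_def o_def)
  show ?thesis
    unfolding tangent_space_def
  proof (intro CollectI conjI allI impI)
    fix F H a assume FH: "smooth_near X A p F" "smooth_near X A p H"
    show "coord_vector X A c p i (\<lambda>q. F q + H q) = coord_vector X A c p i F + coord_vector X A c p i H"
      unfolding cv[OF FH(1)] cv[OF FH(2)] cv[OF smooth_near_add[OF FH]]
      by (rule partial_deriv_add[OF d[OF FH(1)] d[OF FH(2)]])
    show "coord_vector X A c p i (\<lambda>q. a * F q) = a * coord_vector X A c p i F"
      unfolding cv[OF FH(1)] cv[OF smooth_near_mult[OF smooth_near_const[OF p] FH(1)]]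
      by (rule partial_deriv_cmult[OF d[OF FH(1)]])
    show "coord_vector X A c p i (\<lambda>q. F q * H q) = coord_vector X A c p i F * H p + F p * coord_vector X A c p i H"
      unfolding cv[OF FH(1)] cv[OF FH(2)] cv[OF smooth_near_mult[OF FH]]
        partial_deriv_mult[OF d[OF FH(1)] d[OF FH(2)]] chart_inv_left[OF c] ..
  qed (simp add: coord_vector_def)
qed

lemma tangent_linear_combination:
  assumes "\<And>i. i \<in> I \<Longrightarrow> v i \<in> tangent_space X A p"
  shows "(\<lambda>F. \<Sum>i\<in>I. a i * v i F) \<in> tangent_space X A p"
  using assms
  by (simp add: tangent_space_def sum_distrib_left sum_distrib_right distrib_left sum.distrib mult_ac)

text \<open>
  The coordinate functions separate the coordinate vectors, so these are linearly independent and a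
  Riemannian metric has positive definite matrices.
\<close>

lemma coord_vector_coordinate:
  assumes c: "c \<in> A" "p \<in> fst c"
  shows "coord_vector X A c p i (\<lambda>q. snd c q $ a) = (if a = i then 1 else 0)"
proof -
  have "partial_deriv i ((\<lambda>q. snd c q $ a) \<circ> chart_inv c) (snd c p) = partial_deriv i (\<lambda>y. y $ a) (snd c p)"
    by (rule partial_deriv_cong[OF chart_range_open[OF c(1)]]) (use c chart_inv_left[OF c(1)] in auto)
  then show ?thesis
    using smooth_near_coordinate[OF c] by (simp add: coord_vector_def partial_deriv_component)
qed

lemma coord_vector_change:
  assumes c: "c \<in> A" "p \<in> fst c" and d: "d \<in> A" "p \<in> fst d"
  shows "coord_vector X A c p i =
    (\<lambda>F. \<Sum>a\<in>UNIV. jacobian_matrix (\<lambda>x. snd d (chart_inv c x)) (snd c p) $ a $ i * coord_vector X A d p a F)"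
proof
  fix F
  let ?\<phi> = "\<lambda>x. snd d (chart_inv c x)" and ?N = "snd c ` (fst c \<inter> fst d)"
  show "coord_vector X A c p i F =
    (\<Sum>a\<in>UNIV. jacobian_matrix ?\<phi> (snd c p) $ a $ i * coord_vector X A d p a F)"
  proof (cases "smooth_near X A p F")
    case True
    have N: "open ?N" "snd c p \<in> ?N"
      using chart_image_open[OF c(1) chart_openin[OF d(1)]] c d by auto
    have \<phi>p: "?\<phi> (snd c p) = snd d p" using chart_inv_left[OF c] by simp
    have "partial_deriv i (F \<circ> chart_inv c) (snd c p) = partial_deriv i (\<lambda>x. (F \<circ> chart_inv d) (?\<phi> x)) (snd c p)"
      by (rule partial_deriv_cong[OF N]) (use chart_inv_left[OF c(1)] chart_inv_left[OF d(1)] in auto)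
    also have "\<dots> = (\<Sum>a\<in>UNIV. partial_deriv a (F \<circ> chart_inv d) (?\<phi> (snd c p)) *
        partial_deriv i (\<lambda>x. ?\<phi> x $ a) (snd c p))"
      by (rule partial_deriv_chain)
        (use smooth_on_differentiable[OF transition_smooth[OF c(1) d(1)] N]
          smooth_near_differentiable[OF True d] \<phi>p in \<open>simp_all add: o_def\<close>)
    finally show ?thesis
      using True by (simp add: coord_vector_def jacobian_matrix_def \<phi>p mult.commute)
  qed (simp add: coord_vector_def)
qed

end

section \<open>Riemannian manifolds in charts\<close>

locale riemannian_structure = smooth_structure X A
  for X :: "'a topology" and A :: "('a, 'n::finite) chart set" +
  fixes g :: "'a metric_tensor"
  assumes metric: "riemannian_metric X A g"
begin

lemma metric_commute:
  "p \<in> topspace X \<Longrightarrow> u \<in> tangent_space X A p \<Longrightarrow> v \<in> tangent_space X A p \<Longrightarrow> g p u v = g p v u"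
  using metric by (simp add: riemannian_metric_def)

lemma metric_linear:
  assumes "p \<in> topspace X" "u \<in> tangent_space X A p" "v \<in> tangent_space X A p" "w \<in> tangent_space X A p"
  shows "g p (\<lambda>F. a * u F + b * v F) w = a * g p u w + b * g p v w"
  using metric assms by (simp add: riemannian_metric_def)

lemma metric_sum_left:
  assumes p: "p \<in> topspace X" and v: "\<And>i. v i \<in> tangent_space X A p" and w: "w \<in> tangent_space X A p"
    and "finite I"
  shows "g p (\<lambda>F. \<Sum>i\<in>I. a i * v i F) w = (\<Sum>i\<in>I. a i * g p (v i) w)"
  using \<open>finite I\<close>
proof (induction I)
  case empty
  show ?case using metric_linear[OF p v v w, of 0 _ 0] by simp
next
  case (insert k I)
  have "g p (\<lambda>F. \<Sum>i\<in>insert k I. a i * v i F) w = g p (\<lambda>F. a k * v k F + 1 * (\<Sum>i\<in>I. a i * v i F)) w"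
    using insert by simp
  also have "\<dots> = a k * g p (v k) w + 1 * g p (\<lambda>F. \<Sum>i\<in>I. a i * v i F) w"
    by (rule metric_linear[OF p v tangent_linear_combination[OF v] w])
  finally show ?case using insert by simp
qed

lemma metric_sum_both:
  assumes p: "p \<in> topspace X" and v: "\<And>i. v i \<in> tangent_space X A p"
  shows "g p (\<lambda>F. \<Sum>i\<in>(UNIV :: 'n set). a i * v i F) (\<lambda>F. \<Sum>j\<in>(UNIV :: 'n set). b j * v j F) =
    (\<Sum>i\<in>UNIV. \<Sum>j\<in>UNIV. a i * b j * g p (v i) (v j))"
proof -
  have L: "(\<lambda>F. \<Sum>i\<in>(UNIV :: 'n set). b i * v i F) \<in> tangent_space X A p"
    by (rule tangent_linear_combination[OF v])
  have "g p (v i) (\<lambda>F. \<Sum>j\<in>(UNIV :: 'n set). b j * v j F) = (\<Sum>j\<in>UNIV. b j * g p (v i) (v j))" for i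
    using metric_sum_left[where v = v and w = "v i" and a = b and I = UNIV, OF p v v finite] metric_commute[OF p v L, of i] metric_commute[OF p v v, of i]
    by simp
  then show ?thesis
    by (simp add: metric_sum_left[OF p v L] sum_distrib_left mult_ac)
qed

lemma metric_matrix_component:
  "c \<in> A \<Longrightarrow> p \<in> fst c \<Longrightarrow>
    metric_matrix X A g c (snd c p) $ i $ j = g p (coord_vector X A c p i) (coord_vector X A c p j)"
  by (simp add: metric_matrix_def chart_inv_left)

lemma metric_matrix_coordinate_metric:
  assumes c: "c \<in> A"
  shows "coordinate_metric (snd c ` fst c) (metric_matrix X A g c)"
proof
  show "open (snd c ` fst c)" by (rule chart_range_open[OF c])
  show "smooth_on (snd c ` fst c) (\<lambda>x. metric_matrix X A g c x $ i $ j)" for i j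
    using metric c by (simp add: riemannian_metric_def)
  fix x assume "x \<in> snd c ` fst c"
  then obtain p where p: "p \<in> fst c" "x = snd c p" by blast
  have pX: "p \<in> topspace X" using chart_subset[OF c] p by blast
  note t = coord_vector_tangent[OF c p(1)]
  show "metric_matrix X A g c x $ i $ j = metric_matrix X A g c x $ j $ i" for i j
    using metric_commute[OF pX t t] by (simp add: p metric_matrix_component[OF c])
  fix v :: "real^'n" assume "v \<noteq> 0"
  then obtain a where a: "v $ a \<noteq> 0" by (auto simp: vec_eq_iff)
  let ?u = "\<lambda>F. \<Sum>i\<in>UNIV. v $ i * coord_vector X A c p i F"
  have "?u (\<lambda>q. snd c q $ a) = v $ a"
    by (simp add: coord_vector_coordinate[OF c p(1)] mult_delta)
  then have "?u \<noteq> (\<lambda>F. 0)" using a by metis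
  moreover have "?u \<in> tangent_space X A p"
    by (rule tangent_linear_combination[OF t])
  ultimately have "g p ?u ?u > 0"
    using metric pX by (simp add: riemannian_metric_def)
  also have "g p ?u ?u = v \<bullet> (metric_matrix X A g c x *v v)"
    by (simp add: metric_sum_both[OF pX t] p metric_matrix_component[OF c] inner_vec_def
        matrix_vector_mult_def sum_distrib_left mult_ac)
  finally show "v \<bullet> (metric_matrix X A g c x *v v) > 0" .
qed

lemma chart_change_pullback:
  assumes c: "c \<in> A" and d: "d \<in> A"
  shows "metric_pullback (snd c ` (fst c \<inter> fst d)) (snd d ` fst d) (metric_matrix X A g c)
    (metric_matrix X A g d) (\<lambda>x. snd d (chart_inv c x))"
proof -
  interpret dom: coordinate_metric "snd c ` (fst c \<inter> fst d)" "metric_matrix X A g c"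
    by (rule coordinate_metric.restrict_domain[OF metric_matrix_coordinate_metric[OF c]
          chart_image_open[OF c chart_openin[OF d]]]) blast
  interpret cod: coordinate_metric "snd d ` fst d" "metric_matrix X A g d"
    by (rule metric_matrix_coordinate_metric[OF d])
  show ?thesis
  proof
    fix x assume "x \<in> snd c ` (fst c \<inter> fst d)"
    then obtain p where p: "p \<in> fst c" "p \<in> fst d" "x = snd c p" by blast
    have pX: "p \<in> topspace X" using chart_subset[OF c] p by blast
    have inv: "chart_inv c x = p" using chart_inv_left[OF c p(1)] p by simp
    show "snd d (chart_inv c x) \<in> snd d ` fst d" using p inv by simp
    let ?J = "jacobian_matrix (\<lambda>x. snd d (chart_inv c x)) x"
    have "metric_matrix X A g c x $ i $ j =
        (\<Sum>a\<in>UNIV. \<Sum>b\<in>UNIV. ?J $ a $ i * ?J $ b $ j * metric_matrix X A g d (snd d p) $ a $ b)" for i j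
      unfolding p(3) metric_matrix_component[OF c p(1)] metric_matrix_component[OF d p(2)]
        coord_vector_change[OF c p(1) d p(2)]
      by (rule metric_sum_both[OF pX coord_vector_tangent[OF d p(2)]])
    moreover have "(transpose ?J ** metric_matrix X A g d (snd d p) ** ?J) $ i $ j =
       (\<Sum>a\<in>UNIV. \<Sum>b\<in>UNIV. ?J $ a $ i * ?J $ b $ j * metric_matrix X A g d (snd d p) $ a $ b)" for i j
      by (subst sum.swap) (simp add: matrix_matrix_mult_def transpose_def sum_distrib_left sum_distrib_right mult_ac)
    ultimately show "metric_matrix X A g c x =
        transpose ?J ** metric_matrix X A g d (snd d (chart_inv c x)) ** ?J"
      by (simp add: vec_eq_iff inv)
  qed (rule transition_smooth[OF c d])
qed

text \<open>
  The left-hand side is computed in \<open>chart_at A p\<close>, so for fixed \<open>c\<close> and varying \<open>p\<close> this exhibits scalar curvature as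
  one smooth function of the coordinates \<open>c\<close>.
\<close>

lemma scalar_curvature_in_chart:
  assumes c: "c \<in> A" and p: "p \<in> fst c"
  shows "scalar_curvature X A g p = coord_scalar_curvature (metric_matrix X A g c) (snd c p)"
proof -
  let ?d = "chart_at A p"
  have d: "?d \<in> A" "p \<in> fst ?d"
    using chart_at_mem chart_subset[OF c] p by blast+
  interpret metric_pullback "snd c ` (fst c \<inter> fst ?d)" "snd ?d ` fst ?d" "metric_matrix X A g c"
    "metric_matrix X A g ?d" "\<lambda>x. snd ?d (chart_inv c x)"
    by (rule chart_change_pullback[OF c d(1)])
  show ?thesis
    using scalar_curvature_invariant[of "snd c p"] p d
    by (simp add: scalar_curvature_def Let_def chart_inv_left[OF c p])
qed

lemma inner_gradients:
  assumes p: "p \<in> topspace X"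
  defines "c \<equiv> chart_at A p"
  shows "g p (gradient X A g F p) (gradient X A g H p) =
    (\<Sum>i\<in>UNIV. \<Sum>j\<in>UNIV. matrix_inv (metric_matrix X A g c (snd c p)) $ i $ j *
       (partial_deriv i (F \<circ> chart_inv c) (snd c p) * partial_deriv j (H \<circ> chart_inv c) (snd c p)))"
proof -
  have c: "c \<in> A" "p \<in> fst c" using chart_at_mem[OF p] by (simp_all add: c_def)
  interpret coordinate_metric "snd c ` fst c" "metric_matrix X A g c"
    by (rule metric_matrix_coordinate_metric[OF c(1)])
  have x: "snd c p \<in> snd c ` fst c" using c by blast
  define M where "M = matrix_inv (metric_matrix X A g c (snd c p))"
  define G where "G = metric_matrix X A g c (snd c p)"
  define \<alpha> where "\<alpha> F j = (\<Sum>i\<in>UNIV. M $ i $ j * partial_deriv i (F \<circ> chart_inv c) (snd c p))" for F j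
  have grad: "gradient X A g F p = (\<lambda>E. \<Sum>j\<in>UNIV. \<alpha> F j * coord_vector X A c p j E)" for F
    unfolding gradient_def Let_def c_def[symmetric] \<alpha>_def M_def sum_distrib_right
    by (rule ext) (rule sum.swap)
  have GM: "(\<Sum>l\<in>UNIV. M $ k $ l * G $ l $ j) = (if k = j then 1 else 0)" for j k
    using arg_cong[OF matrix_inv_inverse(2)[OF invertible_metric[OF x]], of "\<lambda>N. N $ k $ j"]
    by (simp add: M_def G_def matrix_matrix_mult_def mat_def)
  \<comment> \<open>Lowering the index of the gradient gives back the differential.\<close>
  have lower: "(\<Sum>l\<in>UNIV. \<alpha> F l * G $ l $ j) = partial_deriv j (F \<circ> chart_inv c) (snd c p)" for F j
  proof -
    have "(\<Sum>l\<in>UNIV. \<alpha> F l * G $ l $ j) =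
        (\<Sum>l\<in>UNIV. \<Sum>k\<in>UNIV. M $ k $ l * G $ l $ j * partial_deriv k (F \<circ> chart_inv c) (snd c p))"
      by (simp add: \<alpha>_def sum_distrib_left sum_distrib_right mult_ac)
    also have "\<dots> = (\<Sum>k\<in>UNIV. (\<Sum>l\<in>UNIV. M $ k $ l * G $ l $ j) * partial_deriv k (F \<circ> chart_inv c) (snd c p))"
      by (subst sum.swap) (simp add: sum_distrib_right)
    finally show ?thesis by (simp add: GM delta_mult)
  qed
  have "g p (gradient X A g F p) (gradient X A g H p) = (\<Sum>i\<in>UNIV. \<Sum>j\<in>UNIV. \<alpha> F i * \<alpha> H j * G $ i $ j)"
    unfolding grad metric_sum_both[OF p coord_vector_tangent[OF c]]
    by (simp add: G_def metric_matrix_component[OF c])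
  also have "\<dots> = (\<Sum>j\<in>UNIV. \<alpha> F j * partial_deriv j (H \<circ> chart_inv c) (snd c p))"
  proof -
    have "(\<Sum>j\<in>UNIV. \<alpha> F i * \<alpha> H j * G $ i $ j) = \<alpha> F i * (\<Sum>j\<in>UNIV. \<alpha> H j * G $ j $ i)" for i
      using metric_sym[OF x, of i] by (simp add: G_def sum_distrib_left mult_ac)
    then show ?thesis by (simp add: lower)
  qed
  also have "\<dots> = (\<Sum>i\<in>UNIV. \<Sum>j\<in>UNIV. M $ i $ j *
       (partial_deriv i (F \<circ> chart_inv c) (snd c p) * partial_deriv j (H \<circ> chart_inv c) (snd c p)))"
    unfolding \<alpha>_def sum_distrib_right by (subst sum.swap) (simp add: mult_ac)
  finally show ?thesis by (simp add: M_def)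
qed

end

section \<open>The Laplacian of the scalar curvature of a soliton\<close>

theorem proposition1p3:
  fixes X :: "'a topology" and A :: "('a, 'n::finite) chart set"
    and g :: "'a metric_tensor" and f :: "'a \<Rightarrow> real" and lam :: real
  assumes "CARD('n) \<ge> 2"
    and "gradient_yamabe_soliton X A g f lam"
  shows "\<forall>p\<in>topspace X.
    laplacian X A g (scalar_curvature X A g) p =
      - (1 / (real CARD('n) - 1)) *
        (1/2 * g p (gradient X A g (scalar_curvature X A g) p) (gradient X A g f p)
         + scalar_curvature X A g p * (scalar_curvature X A g p - lam))"
proof
  fix p assume p: "p \<in> topspace X"
  have rm: "riemannian_manifold X A g" and smf: "smooth_fun_on A (topspace X) f"
    and sol: "\<And>c q i j. c \<in> A \<Longrightarrow> q \<in> fst c \<Longrightarrow> hessian X A g c f i j q =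
      (scalar_curvature X A g q - lam) * g q (coord_vector X A c q i) (coord_vector X A c q j)"
    using assms(2) by (auto simp: gradient_yamabe_soliton_def)
  interpret riemannian_structure X A g
    by unfold_locales (use rm in \<open>simp_all add: riemannian_manifold_def smooth_manifold_def\<close>)
  define c where "c = chart_at A p"
  have c: "c \<in> A" "p \<in> fst c" using chart_at_mem[OF p] by (simp_all add: c_def)
  define S G x where "S = snd c ` fst c" and "G = metric_matrix X A g c" and "x = snd c p"
  define R F where "R = coord_scalar_curvature G" and "F = f \<circ> chart_inv c"
  interpret coordinate_metric S G
    unfolding S_def G_def by (rule metric_matrix_coordinate_metric[OF c(1)])
  have x: "x \<in> S" using c by (simp add: x_def S_def)
  have F: "smooth_on S F"
    using smf[unfolded smooth_fun_on_def, rule_format, OF c(1)]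
    unfolding S_def F_def Int_absorb2[OF chart_subset[OF c(1)]] .
  have R: "smooth_on S R" unfolding R_def by (rule smooth_coord_scalar_curvature)
  have Req: "(scalar_curvature X A g \<circ> chart_inv c) y = R y" if "y \<in> S" for y
    using that scalar_curvature_in_chart[OF c(1)] chart_inv_left[OF c(1)] by (auto simp: S_def R_def G_def)
  have hess: "coord_hessian G F i j y = (R y - lam) * G y $ i $ j" if "y \<in> S" for y i j
  proof -
    obtain q where q: "q \<in> fst c" "y = snd c q" using \<open>y \<in> S\<close> unfolding S_def by blast
    show ?thesis
      using sol[OF c(1) q(1), of i j] scalar_curvature_in_chart[OF c(1) q(1)]
      by (simp add: hessian_def G_def F_def R_def q metric_matrix_component[OF c(1) q(1)])
  qed
  have dR: "partial_deriv i (scalar_curvature X A g \<circ> chart_inv c) x = partial_deriv i R x" for i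
    by (rule partial_deriv_cong[OF open_domain x Req])
  have "coord_hessian G (scalar_curvature X A g \<circ> chart_inv c) i j x = coord_hessian G (\<lambda>y. R y - lam) i j x" for i j
    unfolding coord_hessian_diff_const[OF open_domain x R] by (rule coord_hessian_cong[OF open_domain x Req])
  then have lap: "laplacian X A g (scalar_curvature X A g) p =
      (\<Sum>i\<in>UNIV. \<Sum>j\<in>UNIV. matrix_inv (G x) $ i $ j * coord_hessian G (\<lambda>y. R y - lam) i j x)"
    by (simp add: laplacian_def Let_def hessian_def c_def[symmetric] G_def[symmetric] x_def[symmetric])
  have inner: "g p (gradient X A g (scalar_curvature X A g) p) (gradient X A g f p) =
      (\<Sum>i\<in>UNIV. \<Sum>j\<in>UNIV. matrix_inv (G x) $ i $ j * (partial_deriv i R x * partial_deriv j F x))"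
    by (simp add: inner_gradients[OF p] c_def[symmetric] G_def[symmetric] x_def[symmetric] dR F_def)
  have scal: "scalar_curvature X A g p = R x"
    using scalar_curvature_in_chart[OF c] by (simp add: R_def G_def x_def)
  have "(real CARD('n) - 1) * laplacian X A g (scalar_curvature X A g) p =
    - (1/2 * g p (gradient X A g (scalar_curvature X A g) p) (gradient X A g f p)
       + scalar_curvature X A g p * (scalar_curvature X A g p - lam))"
    unfolding lap inner scal R_def
    by (rule conformal_gradient_identity[OF x F _ hess[unfolded R_def]])
      (use smooth_on_diff[OF open_domain R smooth_on_const] in \<open>simp add: R_def\<close>)
  moreover have "real CARD('n) - 1 \<noteq> 0" using assms(1) by simp
  ultimately show "laplacian X A g (scalar_curvature X A g) p =
      - (1 / (real CARD('n) - 1)) *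
        (1/2 * g p (gradient X A g (scalar_curvature X A g) p) (gradient X A g f p)
         + scalar_curvature X A g p * (scalar_curvature X A g p - lam))"
    by (simp add: field_simps)
qed

end
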